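(* Let $\{(x_i,y_i)\}_{i=1}^5\subset\mathbb{P}^2\times\mathbb{P}^2$ be in general position. Then there is a unique new $6$th point $(x_6,y_6)\in\mathbb{P}^2\times\mathbb{P}^2$ such that the $6\times 9$ matrix $Z_6$ with rows $x_i^\top\otimes y_i^\top$, $i=1,\dots,6$, is rank deficient (i.e. $\operatorname{rank}(Z_6)<6$). This $6$th point is a rational function of the first $5$: if homographies are used to fix the first $4$ points as $$x_1=y_1=(1,0,0),\quad x_2=y_2=(0,1,0),\quad x_3=y_3=(0,0,1),\quad x_4=y_4=(1,1,1),$$ and $x_5=(x_{51},x_{52},x_{53})$, $y_5=(y_{51},y_{52},y_{53})$, then the $6$th point has the formula $$x_6=\left(\frac{y_{53}-y_{52}}{y_{53}x_{52}-x_{53}y_{52}},\ \frac{y_{53}-y_{51}}{y_{53}x_{51}-x_{53}y_{51}},\ \frac{y_{51}-y_{52}}{y_{51}x_{52}-x_{51}y_{52}}\right),$$ $$y_6=\left(\frac{x_{53}-x_{52}}{y_{53}x_{52}-x_{53}y_{52}},\ \frac{x_{53}-x_{51}}{y_{53}x_{51}-x_{53}y_{51}},\ \frac{x_{51}-x_{52}}{y_{51}x_{52}-x_{51}y_{52}}\right).$$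
   Context: $\mathbb{P}^2$ is the projective plane over $\mathbb{C}$; points are represented by nonzero column vectors and $\otimes$ is the Kronecker product. "New" means different from the five given point pairs. Points in $\mathbb{P}^2$ are in general position if at most $2$ of them are in a line and at most $5$ of them are on a conic (for five points only the first condition matters). A collection of point pairs $\{(x_i,y_i)\}\subset\mathbb{P}^2\times\mathbb{P}^2$ is in general position if (1) the $x_i$ are in general position and the $y_i$ are in general position, and (2) no more than $4$ of the pairs $(x_i,y_i)$ are related by a homography, i.e. there is no $H\in\mathrm{PGL}(3)$ with $Hx_i=y_i$ for more than $4$ indices $i$.
   Formalization: General position alone does not give a new 6th point (e.g. x5=(1,2,3), y5=(5,2,3) in the standard frame); existence is proved exactly when, for no i, the lines from x_i to the other x_j and those from y_i to the other y_j have equal cross-ratio. *)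

theory Defs
  imports "HOL-Analysis.Analysis"
begin

text \<open>Points of the complex projective plane are represented by nonzero vectors of
  \<open>complex ^ 3\<close>; \<open>proj_eq\<close> is equality of the represented points. A family of points
  indexed by \<open>'n\<close> is a vector of type \<open>complex ^ 3 ^ 'n\<close>. The index types \<open>5\<close> and \<open>6\<close>
  have exactly the elements \<open>1, \<dots>, 5\<close> and \<open>1, \<dots>, 6\<close> (as \<open>5 = 0\<close> and \<open>6 = 0\<close> there).\<close>

definition proj_eq :: "complex ^ 3 \<Rightarrow> complex ^ 3 \<Rightarrow> bool" where
  "proj_eq p q \<longleftrightarrow> p \<noteq> 0 \<and> q \<noteq> 0 \<and> (\<exists>c. p = c *s q)"

definition on_line :: "complex ^ 3 \<Rightarrow> complex ^ 3 \<Rightarrow> bool" where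
  "on_line l p \<longleftrightarrow> (\<Sum>j\<in>UNIV. l $ j * p $ j) = 0"

definition on_conic :: "complex ^ 3 ^ 3 \<Rightarrow> complex ^ 3 \<Rightarrow> bool" where
  "on_conic Q p \<longleftrightarrow> (\<Sum>j\<in>UNIV. \<Sum>k\<in>UNIV. p $ j * Q $ j $ k * p $ k) = 0"

text \<open>Points are counted with their indices, so repeated points are excluded as soon as
  there are at least three of them. Conics may be reducible.\<close>

definition points_general_position :: "complex ^ 3 ^ 'n::finite \<Rightarrow> bool" where
  "points_general_position x \<longleftrightarrow>
     (\<forall>i. x $ i \<noteq> 0) \<and>
     (\<forall>l. l \<noteq> 0 \<longrightarrow> card {i. on_line l (x $ i)} \<le> 2) \<and>
     (\<forall>Q. Q \<noteq> 0 \<and> transpose Q = Q \<longrightarrow> card {i. on_conic Q (x $ i)} \<le> 5)"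

definition pairs_general_position ::
    "complex ^ 3 ^ 'n::finite \<Rightarrow> complex ^ 3 ^ 'n \<Rightarrow> bool" where
  "pairs_general_position x y \<longleftrightarrow>
     points_general_position x \<and> points_general_position y \<and>
     \<not> (\<exists>H. invertible H \<and> card {i. proj_eq (H *v (x $ i)) (y $ i)} > 4)"

definition kron :: "complex ^ 'm \<Rightarrow> complex ^ 'n \<Rightarrow> complex ^ ('m::finite \<times> 'n::finite)" where
  "kron p q = (\<chi> jk. p $ fst jk * q $ snd jk)"

definition pair_matrix ::
    "complex ^ 3 ^ 'n \<Rightarrow> complex ^ 3 ^ 'n \<Rightarrow> complex ^ (3 \<times> 3) ^ 'n::finite" where
  "pair_matrix x y = (\<chi> i. kron (x $ i) (y $ i))"

definition adjoin_sixth :: "complex ^ 3 ^ 5 \<Rightarrow> complex ^ 3 \<Rightarrow> complex ^ 3 ^ 6" where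
  "adjoin_sixth x p = vector [x $ 1, x $ 2, x $ 3, x $ 4, x $ 5, p]"

definition new_sixth_pair ::
    "complex ^ 3 ^ 5 \<Rightarrow> complex ^ 3 ^ 5 \<Rightarrow> complex ^ 3 \<Rightarrow> complex ^ 3 \<Rightarrow> bool" where
  "new_sixth_pair x y p q \<longleftrightarrow>
     p \<noteq> 0 \<and> q \<noteq> 0 \<and>
     \<not> (\<exists>i. proj_eq p (x $ i) \<and> proj_eq q (y $ i)) \<and>
     rank (pair_matrix (adjoin_sixth x p) (adjoin_sixth y q)) < 6"

text \<open>The sixth point of intersection of the Segre variety with the span of the five given
  points may coincide with the \<open>i\<close>-th given one, and then there is no new pair, although the
  five pairs are in general position. For example, this happens with \<open>i = 1\<close> if the first
  four pairs are \<open>(p, p)\<close> for \<open>p = (1,0,0), (0,1,0), (0,0,1), (1,1,1)\<close> and the fifth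
  one is \<open>((1,2,3), (5,2,3))\<close>: the only matrices of rank one in the span of the five matrices
  \<open>x\<^sub>i y\<^sub>i\<^sup>T\<close> are multiples of these five (and one denominator in the formula for the
  sixth point vanishes). In general, the sixth point coincides with the \<open>i\<close>-th given one
  exactly if the four lines joining \<open>x\<^sub>i\<close> to the other \<open>x\<^sub>j\<close> have the same cross-ratio as
  the four lines joining \<open>y\<^sub>i\<close> to the other \<open>y\<^sub>j\<close>. The condition
  \<open>no_equal_pencils\<close> says that this does not happen for any \<open>i\<close>; for a fixed \<open>i\<close>, it does
  not depend on the order of \<open>j, k, l, m\<close>.\<close>

definition bracket :: "complex ^ 3 \<Rightarrow> complex ^ 3 \<Rightarrow> complex ^ 3 \<Rightarrow> complex" where
  "bracket p q r = det (vector [p, q, r] :: complex ^ 3 ^ 3)"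

definition pencil_cross_ratio :: "complex ^ 3 ^ 5 \<Rightarrow> 5 \<Rightarrow> 5 \<Rightarrow> 5 \<Rightarrow> 5 \<Rightarrow> 5 \<Rightarrow> complex" where
  "pencil_cross_ratio x i j k l m =
     (bracket (x $ i) (x $ j) (x $ l) * bracket (x $ i) (x $ k) (x $ m)) /
     (bracket (x $ i) (x $ j) (x $ m) * bracket (x $ i) (x $ k) (x $ l))"

definition no_equal_pencils :: "complex ^ 3 ^ 5 \<Rightarrow> complex ^ 3 ^ 5 \<Rightarrow> bool" where
  "no_equal_pencils x y \<longleftrightarrow>
     (\<forall>i j k l m. distinct [i, j, k, l, m] \<longrightarrow>
        pencil_cross_ratio x i j k l m \<noteq> pencil_cross_ratio y i j k l m)"

text \<open>Polynomial functions of the 30 coordinates of five pairs. A rational map to the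
  projective plane is given by three such functions as homogeneous coordinates.\<close>

inductive pairs_polynomial ::
    "(complex ^ 3 ^ 5 \<Rightarrow> complex ^ 3 ^ 5 \<Rightarrow> complex) \<Rightarrow> bool" where
  const: "pairs_polynomial (\<lambda>x y. c)"
| coord_x: "pairs_polynomial (\<lambda>x y. x $ i $ j)"
| coord_y: "pairs_polynomial (\<lambda>x y. y $ i $ j)"
| add: "pairs_polynomial f \<Longrightarrow> pairs_polynomial g \<Longrightarrow> pairs_polynomial (\<lambda>x y. f x y + g x y)"
| mult: "pairs_polynomial f \<Longrightarrow> pairs_polynomial g \<Longrightarrow> pairs_polynomial (\<lambda>x y. f x y * g x y)"

definition standard_frame :: "complex ^ 3 ^ 4" where
  "standard_frame =
     vector [vector [1, 0, 0], vector [0, 1, 0], vector [0, 0, 1], vector [1, 1, 1]]"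

text \<open>The homography \<open>H\<close> moves the first four points to the standard frame.\<close>

definition fixes_first_four :: "complex ^ 3 ^ 3 \<Rightarrow> complex ^ 3 ^ 5 \<Rightarrow> bool" where
  "fixes_first_four H x \<longleftrightarrow> invertible H \<and>
     proj_eq (H *v (x $ 1)) (standard_frame $ 1) \<and>
     proj_eq (H *v (x $ 2)) (standard_frame $ 2) \<and>
     proj_eq (H *v (x $ 3)) (standard_frame $ 3) \<and>
     proj_eq (H *v (x $ 4)) (standard_frame $ 4)"

end

theory Submission
  imports Defs
begin

text \<open>The \<open>6 \<times> 9\<close> matrix is rank deficient exactly if the matrices \<open>x\<^sub>i y\<^sub>i\<^sup>T\<close> are linearly dependent, a
  condition that homographies of the two planes preserve. So the first four points on both sides may
  be moved to the standard frame, and the fifth ones become \<open>a\<close> and \<open>b\<close>. The first three pairs then span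
  the diagonal matrices, and the condition on a sixth pair \<open>(p, q)\<close> becomes
  \<open>p\<^sub>i q\<^sub>j = s + t a\<^sub>i b\<^sub>j\<close> for all \<open>i \<noteq> j\<close> and some \<open>s\<close> and \<open>t\<close> (\<open>rank_framed_less_iff\<close>).

  If \<open>s\<close> or \<open>t\<close> vanishes, the pair is one of the given ones. Otherwise the relation
  \<open>m\<^sub>1\<^sub>2 m\<^sub>2\<^sub>3 m\<^sub>3\<^sub>1 = m\<^sub>2\<^sub>1 m\<^sub>3\<^sub>2 m\<^sub>1\<^sub>3\<close> between the off-diagonal entries of a rank-one matrix, a cubic in \<open>(s : t)\<close>
  with the known roots \<open>0\<close> and \<open>\<infinity>\<close>, leaves a linear equation. Its coefficients are \<open>lin_det a b\<close> and
  \<open>cremona_det a b\<close>. With the resulting \<open>(s : t)\<close> each entry \<open>s + t a\<^sub>i b\<^sub>j\<close> is a product of three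
  differences (\<open>off_diagonal_factorization\<close>), from which \<open>p\<close> and \<open>q\<close> can be read off; this proves the
  formula and the uniqueness (\<open>frame_solution\<close>).

  The pair so found is new exactly if the two coefficients and the three denominators of the formula
  are nonzero. These five numbers are, up to sign, the cleared differences between the cross-ratio of
  the pencil at \<open>x\<^sub>i\<close> and that of the pencil at \<open>y\<^sub>i\<close> (\<open>pencil_gap_framed\<close>), whence the criterion
  for existence. Finally, the passage to frame coordinates is polynomial up to scalars by Cramer's rule,
  so the sixth pair is a rational function of the five given ones (\<open>poly_map_sixth\<close>).\<close>

section \<open>Index types with five and six elements\<close>

lemma exhaust_5: "i = 1 \<or> i = 2 \<or> i = 3 \<or> i = 4 \<or> i = 5" for i :: 5
proof (induct i)
  case (of_int z)
  then have "z = 0 \<or> z = 1 \<or> z = 2 \<or> z = 3 \<or> z = 4" by fastforce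
  then show ?case by auto
qed

lemma cases_5:
  fixes i :: 5
  obtains "i = 1" | "i = 2" | "i = 3" | "i = 4" | "i = 5"
  using exhaust_5[of i] by blast

lemma exhaust_6: "i = 1 \<or> i = 2 \<or> i = 3 \<or> i = 4 \<or> i = 5 \<or> i = 6" for i :: 6
proof (induct i)
  case (of_int z)
  then have "z = 0 \<or> z = 1 \<or> z = 2 \<or> z = 3 \<or> z = 4 \<or> z = 5" by fastforce
  then show ?case by auto
qed

lemma forall_5: "(\<forall>i::5. P i) \<longleftrightarrow> P 1 \<and> P 2 \<and> P 3 \<and> P 4 \<and> P 5"
  by (metis exhaust_5)

lemma forall_6: "(\<forall>i::6. P i) \<longleftrightarrow> P 1 \<and> P 2 \<and> P 3 \<and> P 4 \<and> P 5 \<and> P 6"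
  by (metis exhaust_6)

lemma sum_6: "sum f (UNIV :: 6 set) = f 1 + f 2 + f 3 + f 4 + f 5 + f 6"
proof -
  have *: "(UNIV :: 6 set) = {1, 2, 3, 4, 5, 6}"
    using exhaust_6 by auto
  show ?thesis unfolding * by (simp add: ac_simps)
qed

lemma vector_4_nth [simp]:
  "(vector [x1, x2, x3, x4] :: 'a::zero ^ 4) $ 1 = x1"
  "(vector [x1, x2, x3, x4] :: 'a::zero ^ 4) $ 2 = x2"
  "(vector [x1, x2, x3, x4] :: 'a::zero ^ 4) $ 3 = x3"
  "(vector [x1, x2, x3, x4] :: 'a::zero ^ 4) $ 4 = x4"
  unfolding vector_def by simp_all

lemma vector_5_nth [simp]:
  "(vector [x1, x2, x3, x4, x5] :: 'a::zero ^ 5) $ 1 = x1"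
  "(vector [x1, x2, x3, x4, x5] :: 'a::zero ^ 5) $ 2 = x2"
  "(vector [x1, x2, x3, x4, x5] :: 'a::zero ^ 5) $ 3 = x3"
  "(vector [x1, x2, x3, x4, x5] :: 'a::zero ^ 5) $ 4 = x4"
  "(vector [x1, x2, x3, x4, x5] :: 'a::zero ^ 5) $ 5 = x5"
  unfolding vector_def by simp_all

lemma adjoin_sixth_nth [simp]:
  "adjoin_sixth x p $ 1 = x $ 1" "adjoin_sixth x p $ 2 = x $ 2" "adjoin_sixth x p $ 3 = x $ 3"
  "adjoin_sixth x p $ 4 = x $ 4" "adjoin_sixth x p $ 5 = x $ 5" "adjoin_sixth x p $ 6 = p"
  unfolding adjoin_sixth_def vector_def by simp_all

section \<open>Rank deficiency as a relation between the pairs\<close>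

lemma rank_less_iff_dependent_rows:
  fixes A :: "'a::field ^ 'n ^ 'm"
  shows "rank A < CARD('m) \<longleftrightarrow> (\<exists>c. (\<exists>i. c i \<noteq> 0) \<and> (\<Sum>i\<in>UNIV. c i *s row i A) = 0)"
proof
  assume less: "rank A < CARD('m)"
  show "\<exists>c. (\<exists>i. c i \<noteq> 0) \<and> (\<Sum>i\<in>UNIV. c i *s row i A) = 0"
  proof (rule ccontr)
    assume "\<not> ?thesis"
    then have trivial: "c i = 0" if "(\<Sum>i\<in>UNIV. c i *s row i A) = 0" for c i
      using that by blast
    have inj: "inj (\<lambda>i. row i A)"
    proof (rule injI, rule ccontr)
      fix i j assume eq: "row i A = row j A" and "i \<noteq> j"
      define c where "c l = (if l = i then 1 else if l = j then - 1 else (0::'a))" for l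
      have "(\<Sum>l\<in>UNIV. c l *s row l A) = (\<Sum>l\<in>{i, j}. c l *s row l A)"
        by (rule sum.mono_neutral_right) (auto simp: c_def)
      also have "\<dots> = 0"
        using \<open>i \<noteq> j\<close> eq by (simp add: c_def vec_eq_iff)
      finally show False
        using trivial[of c i] by (simp add: c_def)
    qed
    have rows: "rows A = range (\<lambda>i. row i A)"
      by (auto simp: rows_def)
    have "vec.independent (rows A)"
      unfolding vec.independent_explicit
    proof (intro conjI allI impI ballI)
      show "finite (rows A)" by (simp add: rows)
      fix u v assume "(\<Sum>v\<in>rows A. u v *s v) = 0" and v: "v \<in> rows A"
      then have "(\<Sum>i\<in>UNIV. u (row i A) *s row i A) = 0"
        by (simp add: rows sum.reindex[OF inj])
      with v show "u v = 0"
        using trivial[of "\<lambda>i. u (row i A)"] by (auto simp: rows)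
    qed
    then have "rank A = card (rows A)"
      by (simp add: row_rank_def_gen vec.dim_eq_card_independent)
    also have "\<dots> = CARD('m)"
      by (simp add: rows card_image[OF inj])
    finally show False using less by simp
  qed
next
  assume "\<exists>c. (\<exists>i. c i \<noteq> 0) \<and> (\<Sum>i\<in>UNIV. c i *s row i A) = 0"
  then obtain c i where c: "(\<Sum>i\<in>UNIV. c i *s row i A) = 0" "c i \<noteq> 0" by blast
  \<comment> \<open>The row with nonzero coefficient lies in the span of the others.\<close>
  define R where "R = (\<lambda>j. row j A) ` (UNIV - {i})"
  have "c i *s row i A = - (\<Sum>j\<in>UNIV - {i}. c j *s row j A)"
    using c(1) by (simp add: sum.remove[of UNIV i] eq_neg_iff_add_eq_0)
  then have "inverse (c i) *s (c i *s row i A) \<in> vec.span R"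
    unfolding R_def
    by (auto intro!: vec.span_scale vec.span_neg vec.span_sum intro: vec.span_base)
  then have "row i A \<in> vec.span R"
    using c(2) by (simp add: vector_smult_assoc)
  moreover have "row j A \<in> vec.span R" if "j \<noteq> i" for j
    using that by (intro vec.span_base) (simp add: R_def)
  ultimately have "row j A \<in> vec.span R" for j
    by (cases "j = i") simp_all
  then have "rows A \<subseteq> vec.span R"
    by (auto simp: rows_def)
  then have "rank A \<le> card R"
    unfolding row_rank_def_gen by (intro vec.dim_le_card) (simp_all add: R_def)
  also have "\<dots> \<le> card (UNIV - {i})"
    unfolding R_def by (rule card_image_le) simp
  also have "\<dots> < CARD('m)"
    by (simp add: card_Diff_singleton)
  finally show "rank A < CARD('m)" .
qed

text \<open>The rows of the matrix are the rank-one matrices \<open>x\<^sub>i y\<^sub>i\<^sup>T\<close>, so the rank drops exactly if these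
  satisfy a nontrivial linear relation, which is written here entry by entry. All later arguments
  work with the coefficients of this relation.\<close>

lemma rank_pair_matrix_less_iff:
  fixes x y :: "complex ^ 3 ^ 'n::finite"
  shows "rank (pair_matrix x y) < CARD('n) \<longleftrightarrow>
    (\<exists>c. (\<exists>i. c i \<noteq> 0) \<and> (\<forall>j k. (\<Sum>i\<in>UNIV. c i * (x $ i $ j * y $ i $ k)) = 0))"
  unfolding rank_less_iff_dependent_rows
  by (simp add: vec_eq_iff row_def pair_matrix_def kron_def)

section \<open>Homographies\<close>

lemma proj_eq_sym: "proj_eq p q \<Longrightarrow> proj_eq q p"
proof -
  assume pq: "proj_eq p q"
  then obtain c where c: "p = c *s q" by (auto simp: proj_eq_def)
  then have "c \<noteq> 0" using pq by (auto simp: proj_eq_def)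
  then have "q = inverse c *s p" using c by (simp add: vector_smult_assoc)
  then show ?thesis using pq unfolding proj_eq_def by blast
qed

lemma proj_eq_trans: "proj_eq p q \<Longrightarrow> proj_eq q r \<Longrightarrow> proj_eq p r"
  by (auto simp: proj_eq_def vector_smult_assoc)

lemma proj_eq_smult: "c \<noteq> 0 \<Longrightarrow> p \<noteq> 0 \<Longrightarrow> proj_eq (c *s p) p"
  by (auto simp: proj_eq_def)

lemma proj_eqE:
  assumes "proj_eq p q"
  obtains c where "c \<noteq> 0" "p = c *s q" "p \<noteq> 0" "q \<noteq> 0"
  using assms by (auto simp: proj_eq_def)

lemma invertible_mult_zero_iff: "invertible H \<Longrightarrow> H *v p = 0 \<longleftrightarrow> p = 0"
  for H :: "complex ^ 3 ^ 3"
  by (metis invertible_left_inverse matrix_left_invertible_ker matrix_vector_mult_0_right)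

lemma proj_eq_mult_iff:
  assumes "invertible H"
  shows "proj_eq (H *v p) (H *v q) \<longleftrightarrow> proj_eq p q"
proof -
  have "H *v p = c *s (H *v q) \<longleftrightarrow> p = c *s q" for c
    using invertible_mult_zero_iff[OF assms, of "p - c *s q"]
    by (simp add: matrix_vector_mult_diff_distrib vector_scalar_commute)
  then show ?thesis
    by (simp add: proj_eq_def invertible_mult_zero_iff[OF assms])
qed

text \<open>Homographies act on families of points only up to scalars, since a homography that moves
  four points to the standard frame moves their vectors only to multiples of the frame vectors. The following relation
  therefore compares points and not vectors.\<close>

definition moves :: "complex ^ 3 ^ 3 \<Rightarrow> complex ^ 3 ^ 'n \<Rightarrow> complex ^ 3 ^ 'n::finite \<Rightarrow> bool" where
  "moves H x x' \<longleftrightarrow> invertible H \<and> (\<forall>i. proj_eq (H *v (x $ i)) (x' $ i))"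

lemma moves_scalars:
  assumes "moves H x x'"
  obtains \<alpha> where "\<And>i. H *v (x $ i) = \<alpha> i *s x' $ i" "\<And>i. \<alpha> i \<noteq> 0"
proof -
  have "\<exists>c. c \<noteq> 0 \<and> H *v (x $ i) = c *s x' $ i" for i
    using assms unfolding moves_def by (blast elim: proj_eqE)
  then show thesis using that by metis
qed

lemma proj_eq_moves_iff:
  assumes "moves H x x'"
  shows "proj_eq (H *v p) (x' $ i) \<longleftrightarrow> proj_eq p (x $ i)"
proof -
  have "proj_eq (H *v (x $ i)) (x' $ i)" "invertible H"
    using assms by (simp_all add: moves_def)
  then have "proj_eq (H *v p) (x' $ i) \<longleftrightarrow> proj_eq (H *v p) (H *v (x $ i))"
    by (blast intro: proj_eq_sym proj_eq_trans)
  with \<open>invertible H\<close> show ?thesis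
    by (simp add: proj_eq_mult_iff)
qed

lemma moves_back:
  assumes "moves H x x'"
  obtains G where "moves G x' x" "\<And>v. G *v (H *v v) = v"
proof -
  obtain G where G: "G ** H = mat 1" "H ** G = mat 1"
    using assms by (auto simp: moves_def invertible_def)
  have id: "G *v (H *v v) = v" for v
    by (simp add: matrix_vector_mul_assoc G)
  have "invertible G" using G by (auto simp: invertible_def)
  moreover have "proj_eq (G *v (x' $ i)) (G *v (H *v (x $ i)))" for i
    unfolding proj_eq_mult_iff[OF \<open>invertible G\<close>]
    using assms by (simp add: moves_def proj_eq_sym)
  ultimately show thesis by (intro that[of G] id) (simp add: moves_def id)
qed

lemma moves_adjoin_sixth:
  assumes "moves H x x'" "p \<noteq> 0"
  shows "moves H (adjoin_sixth x p) (adjoin_sixth x' (H *v p))"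
  using assms proj_eq_smult[of 1 "H *v p"]
  by (simp add: moves_def forall_5 forall_6 invertible_mult_zero_iff)

text \<open>A relation \<open>\<Sum> c\<^sub>i x\<^sub>i y\<^sub>i\<^sup>T = 0\<close> is multiplied by \<open>H\<close> from the left and by \<open>K\<^sup>T\<close> from the right;
  the scalars by which the image vectors differ from the chosen representatives are absorbed into
  the coefficients.\<close>

lemma rank_pair_matrix_less_moves:
  fixes x y :: "complex ^ 3 ^ 'n::finite"
  assumes H: "moves H x x'" and K: "moves K y y'"
    and less: "rank (pair_matrix x y) < CARD('n)"
  shows "rank (pair_matrix x' y') < CARD('n)"
proof -
  obtain \<alpha> where \<alpha>: "\<And>i. H *v (x $ i) = \<alpha> i *s x' $ i" "\<And>i. \<alpha> i \<noteq> 0"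
    using moves_scalars[OF H] by blast
  obtain \<beta> where \<beta>: "\<And>i. K *v (y $ i) = \<beta> i *s y' $ i" "\<And>i. \<beta> i \<noteq> 0"
    using moves_scalars[OF K] by blast
  obtain c where c: "\<exists>i. c i \<noteq> 0" "\<And>j k. (\<Sum>i\<in>UNIV. c i * (x $ i $ j * y $ i $ k)) = 0"
    using less unfolding rank_pair_matrix_less_iff by auto
  have "(\<Sum>i\<in>UNIV. c i * \<alpha> i * \<beta> i * (x' $ i $ j * y' $ i $ k)) = 0" for j k
  proof -
    have "(\<Sum>i\<in>UNIV. c i * \<alpha> i * \<beta> i * (x' $ i $ j * y' $ i $ k)) =
        (\<Sum>i\<in>UNIV. c i * ((H *v (x $ i)) $ j * (K *v (y $ i)) $ k))"
      by (simp add: \<alpha> \<beta> mult_ac)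
    also have "\<dots> = (\<Sum>i\<in>UNIV. \<Sum>l\<in>UNIV. \<Sum>m\<in>UNIV. H $ j $ l * K $ k $ m * (c i * (x $ i $ l * y $ i $ m)))"
      by (simp only: matrix_vector_mult_def vec_lambda_beta sum_product) (simp add: sum_distrib_left mult_ac)
    also have "\<dots> = (\<Sum>l\<in>UNIV. \<Sum>i\<in>UNIV. \<Sum>m\<in>UNIV. H $ j $ l * K $ k $ m * (c i * (x $ i $ l * y $ i $ m)))"
      by (rule sum.swap)
    also have "\<dots> = (\<Sum>l\<in>UNIV. \<Sum>m\<in>UNIV. \<Sum>i\<in>UNIV. H $ j $ l * K $ k $ m * (c i * (x $ i $ l * y $ i $ m)))"
      by (intro sum.cong refl sum.swap)
    also have "\<dots> = 0"
      by (simp only: sum_distrib_left[symmetric] c(2) mult_zero_right sum.neutral_const)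
    finally show ?thesis .
  qed
  moreover have "\<exists>i. c i * \<alpha> i * \<beta> i \<noteq> 0"
    using c(1) \<alpha>(2) \<beta>(2) by auto
  ultimately show ?thesis
    unfolding rank_pair_matrix_less_iff
    by (intro exI[of _ "\<lambda>i. c i * \<alpha> i * \<beta> i"] conjI allI)
qed

lemma new_sixth_pair_moves:
  assumes H: "moves H x x'" and K: "moves K y y'" and new: "new_sixth_pair x y p q"
  shows "new_sixth_pair x' y' (H *v p) (K *v q)"
proof -
  have inv: "invertible H" "invertible K"
    using H K by (auto simp: moves_def)
  have pq: "p \<noteq> 0" "q \<noteq> 0" and rank: "rank (pair_matrix (adjoin_sixth x p) (adjoin_sixth y q)) < 6"
    using new by (auto simp: new_sixth_pair_def)
  have "proj_eq p (x $ i)" if "proj_eq (H *v p) (x' $ i)" for i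
    using proj_eq_moves_iff[OF H] that by simp
  moreover have "proj_eq q (y $ i)" if "proj_eq (K *v q) (y' $ i)" for i
    using proj_eq_moves_iff[OF K] that by simp
  ultimately have "\<not> (\<exists>i. proj_eq (H *v p) (x' $ i) \<and> proj_eq (K *v q) (y' $ i))"
    using new unfolding new_sixth_pair_def by blast
  moreover have "rank (pair_matrix (adjoin_sixth x' (H *v p)) (adjoin_sixth y' (K *v q))) < 6"
    using rank_pair_matrix_less_moves[OF moves_adjoin_sixth[OF H pq(1)] moves_adjoin_sixth[OF K pq(2)]] rank
    by simp
  ultimately show ?thesis
    by (simp add: new_sixth_pair_def invertible_mult_zero_iff inv pq)
qed

section \<open>Brackets\<close>

lemma bracket_expand:
  "bracket p q r = p$1 * q$2 * r$3 + p$2 * q$3 * r$1 + p$3 * q$1 * r$2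
     - p$1 * q$3 * r$2 - p$2 * q$1 * r$3 - p$3 * q$2 * r$1"
  unfolding bracket_def det_3 vector_3 by (rule refl)

lemma bracket_smult: "bracket (a *s p) (b *s q) (c *s r) = a * b * c * bracket p q r"
  unfolding bracket_expand vector_smult_component by (simp add: algebra_simps)

lemma bracket_mult: "bracket (H *v p) (H *v q) (H *v r) = det H * bracket p q r"
proof -
  have *: "(vector [H *v p, H *v q, H *v r] :: complex ^ 3 ^ 3) = transpose (H ** transpose (vector [p, q, r]))"
    by (simp add: vec_eq_iff forall_3 transpose_def matrix_matrix_mult_def matrix_vector_mult_def)
  then show ?thesis
    unfolding bracket_def by (simp add: * det_mul)
qed

text \<open>A vanishing determinant has a nonzero kernel vector, and this is a line through all three
  points.\<close>

lemma bracket_nonzero_if_general_position: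
  assumes gp: "points_general_position x" and "i \<noteq> j" "i \<noteq> k" "j \<noteq> k"
  shows "bracket (x $ i) (x $ j) (x $ k) \<noteq> 0"
proof
  assume "bracket (x $ i) (x $ j) (x $ k) = 0"
  then have "\<not> invertible (vector [x $ i, x $ j, x $ k] :: complex ^ 3 ^ 3)"
    by (simp add: bracket_def invertible_det_nz)
  then obtain l where l: "(vector [x $ i, x $ j, x $ k] :: complex ^ 3 ^ 3) *v l = 0" "l \<noteq> 0"
    by (auto simp: invertible_left_inverse matrix_left_invertible_ker)
  then have "{i, j, k} \<subseteq> {i. on_line l (x $ i)}"
    by (auto simp: vec_eq_iff forall_3 on_line_def matrix_vector_mult_def mult.commute)
  then have "card {i, j, k} \<le> card {i. on_line l (x $ i)}"
    by (intro card_mono) auto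
  moreover have "card {i. on_line l (x $ i)} \<le> 2"
    using gp l(2) by (auto simp: points_general_position_def)
  ultimately show False
    using assms by auto
qed

lemma bracket_moves_nonzero_iff:
  assumes "moves H x x'"
  shows "bracket (x' $ i) (x' $ j) (x' $ k) = 0 \<longleftrightarrow> bracket (x $ i) (x $ j) (x $ k) = 0"
proof -
  obtain \<alpha> where \<alpha>: "\<And>i. H *v (x $ i) = \<alpha> i *s x' $ i" "\<And>i. \<alpha> i \<noteq> 0"
    using moves_scalars[OF assms] by blast
  have "det H \<noteq> 0" using assms by (simp add: moves_def invertible_det_nz)
  moreover have "\<alpha> i * \<alpha> j * \<alpha> k * bracket (x' $ i) (x' $ j) (x' $ k) = det H * bracket (x $ i) (x $ j) (x $ k)"
    using bracket_mult[of H "x $ i" "x $ j" "x $ k"] by (simp only: \<alpha>(1) bracket_smult)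
  ultimately show ?thesis
    using \<alpha>(2) by (metis mult_eq_0_iff)
qed

text \<open>Every point occurs equally often in the numerator and in the denominator, and both have two
  brackets. Hence the scalars of the points and the two factors \<open>det H\<close> cancel.\<close>

lemma pencil_cross_ratio_moves:
  assumes "moves H x x'"
  shows "pencil_cross_ratio x' = pencil_cross_ratio x"
proof (intro ext)
  fix i j k l m :: 5
  obtain \<alpha> where \<alpha>: "\<And>i. H *v (x $ i) = \<alpha> i *s x' $ i" "\<And>i. \<alpha> i \<noteq> 0"
    using moves_scalars[OF assms] by blast
  have d: "det H \<noteq> 0" using assms by (simp add: moves_def invertible_det_nz)
  have br: "bracket (x $ i) (x $ j) (x $ k) =
      \<alpha> i * \<alpha> j * \<alpha> k / det H * bracket (x' $ i) (x' $ j) (x' $ k)" for i j k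
    using bracket_mult[of H "x $ i" "x $ j" "x $ k"] d
    by (simp add: \<alpha>(1) bracket_smult field_simps)
  define z where "z = (\<alpha> i * \<alpha> i * \<alpha> j * \<alpha> k * \<alpha> l * \<alpha> m) / (det H * det H)"
  have "z \<noteq> 0" using \<alpha>(2) d by (simp add: z_def)
  have "pencil_cross_ratio x i j k l m =
     (z * (bracket (x' $ i) (x' $ j) (x' $ l) * bracket (x' $ i) (x' $ k) (x' $ m))) /
     (z * (bracket (x' $ i) (x' $ j) (x' $ m) * bracket (x' $ i) (x' $ k) (x' $ l)))"
    unfolding pencil_cross_ratio_def br z_def by (simp add: mult_ac)
  then show "pencil_cross_ratio x' i j k l m = pencil_cross_ratio x i j k l m"
    using \<open>z \<noteq> 0\<close> by (simp add: pencil_cross_ratio_def)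
qed

section \<open>Cross-ratios of pencils\<close>

text \<open>The difference of the two cross-ratios after clearing denominators.\<close>

definition pencil_gap :: "complex ^ 3 ^ 5 \<Rightarrow> complex ^ 3 ^ 5 \<Rightarrow> 5 \<Rightarrow> 5 \<Rightarrow> 5 \<Rightarrow> 5 \<Rightarrow> 5 \<Rightarrow> complex" where
  "pencil_gap x y i j k l m =
     (bracket (x$i) (x$j) (x$l) * bracket (x$i) (x$k) (x$m)) *
     (bracket (y$i) (y$j) (y$m) * bracket (y$i) (y$k) (y$l)) -
     (bracket (y$i) (y$j) (y$l) * bracket (y$i) (y$k) (y$m)) *
     (bracket (x$i) (x$j) (x$m) * bracket (x$i) (x$k) (x$l))"

lemma bracket_swap: "bracket p r q = - bracket p q r"
  by (simp add: bracket_expand)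

text \<open>The three-term Pluecker relation for the pencil of lines through \<open>p\<close>.\<close>

lemma bracket_pluecker:
  "bracket p q r * bracket p s t = bracket p q s * bracket p r t - bracket p q t * bracket p r s"
  unfolding bracket_expand by algebra

lemma pencil_gap_swap12: "pencil_gap x y i k j l m = - pencil_gap x y i j k l m"
  by (simp add: pencil_gap_def)

lemma pencil_gap_swap34: "pencil_gap x y i j k m l = - pencil_gap x y i j k l m"
  by (simp add: pencil_gap_def)

text \<open>With \<open>X = [ijl][ikm]\<close> and \<open>Y = [ijm][ikl]\<close> for \<open>x\<close> and with \<open>X'\<close>, \<open>Y'\<close> for \<open>y\<close>, the gap is the
  determinant \<open>X Y' - X' Y\<close>. Exchanging \<open>k\<close> and \<open>l\<close> changes \<open>(X, Y)\<close> to \<open>(X - Y, - Y)\<close> by the Pluecker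
  relation. Together with the two obvious symmetries, the gap is alternating in \<open>j, k, l, m\<close>.\<close>

lemma pencil_gap_swap23: "pencil_gap x y i j l k m = - pencil_gap x y i j k l m"
  unfolding pencil_gap_def
  unfolding bracket_pluecker[of _ "x$j" "x$k" "x$l" "x$m"] bracket_pluecker[of _ "y$j" "y$k" "y$l" "y$m"]
  unfolding bracket_swap[of _ "x$l" "x$k"] bracket_swap[of _ "y$l" "y$k"]
  by (simp add: algebra_simps)

lemma pencil_gap_zero_permute:
  "pencil_gap x y i k j l m = 0 \<longleftrightarrow> pencil_gap x y i j k l m = 0"
  "pencil_gap x y i j l k m = 0 \<longleftrightarrow> pencil_gap x y i j k l m = 0"
  "pencil_gap x y i j k m l = 0 \<longleftrightarrow> pencil_gap x y i j k l m = 0"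
  by (simp_all only: pencil_gap_swap12[of x y i k j] pencil_gap_swap23[of x y i j l k]
      pencil_gap_swap34[of x y i j k m l] neg_equal_0_iff_equal)

text \<open>For a relation that is symmetric in its last four arguments, one order of them is enough for
  each first argument. The symmetry is assumed for adjacent arguments; used as rewrite rules, these
  equations sort the four arguments.\<close>

lemma all_distinct_5_if_symmetric:
  fixes G :: "5 \<Rightarrow> 5 \<Rightarrow> 5 \<Rightarrow> 5 \<Rightarrow> 5 \<Rightarrow> bool"
  assumes permute: "\<And>i j k l m. G i k j l m = G i j k l m" "\<And>i j k l m. G i j l k m = G i j k l m"
      "\<And>i j k l m. G i j k m l = G i j k l m"
    and G: "\<not> G 1 2 3 4 5" "\<not> G 2 1 3 4 5" "\<not> G 3 1 2 4 5" "\<not> G 4 1 2 3 5" "\<not> G 5 1 2 3 4"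
    and distinct: "distinct [i, j, k, l, m]"
  shows "\<not> G i j k l m"
  using distinct
  by (cases i rule: cases_5; simp; cases j rule: cases_5; simp; cases k rule: cases_5; simp;
      cases l rule: cases_5; simp; cases m rule: cases_5; simp add: permute G)

text \<open>Since the gap alternates, one order of the other four points suffices for each centre of a
  pencil.\<close>

lemma no_equal_pencils_iff_pencil_gap:
  assumes x: "\<And>i j k. distinct [i, j, k] \<Longrightarrow> bracket (x$i) (x$j) (x$k) \<noteq> 0"
    and y: "\<And>i j k. distinct [i, j, k] \<Longrightarrow> bracket (y$i) (y$j) (y$k) \<noteq> 0"
  shows "no_equal_pencils x y \<longleftrightarrow>
    pencil_gap x y 1 2 3 4 5 \<noteq> 0 \<and> pencil_gap x y 2 1 3 4 5 \<noteq> 0 \<and> pencil_gap x y 3 1 2 4 5 \<noteq> 0 \<and>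
    pencil_gap x y 4 1 2 3 5 \<noteq> 0 \<and> pencil_gap x y 5 1 2 3 4 \<noteq> 0" (is "_ \<longleftrightarrow> ?R")
proof -
  have eq: "pencil_cross_ratio x i j k l m = pencil_cross_ratio y i j k l m \<longleftrightarrow>
      pencil_gap x y i j k l m = 0" if "distinct [i, j, k, l, m]" for i j k l m
    unfolding pencil_cross_ratio_def pencil_gap_def using that by (simp add: frac_eq_eq x y)
  show ?thesis
  proof
    assume L: "no_equal_pencils x y"
    have "pencil_gap x y i j k l m \<noteq> 0" if "distinct [i, j, k, l, m]" for i j k l m
      using L that eq[OF that] unfolding no_equal_pencils_def by blast
    then show ?R by simp
  next
    assume R: ?R
    show "no_equal_pencils x y"
      unfolding no_equal_pencils_def
    proof (intro allI impI)
      fix i j k l m :: 5 assume d: "distinct [i, j, k, l, m]"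
      have "\<not> pencil_gap x y i j k l m = 0"
        using R by - (rule all_distinct_5_if_symmetric[OF pencil_gap_zero_permute _ _ _ _ _ d], simp_all)
      then show "pencil_cross_ratio x i j k l m \<noteq> pencil_cross_ratio y i j k l m"
        using eq[OF d] by simp
    qed
  qed
qed

section \<open>Five pairs in normal form\<close>

definition framed :: "complex ^ 3 \<Rightarrow> complex ^ 3 ^ 5" where
  "framed a = vector [vector [1, 0, 0], vector [0, 1, 0], vector [0, 0, 1], vector [1, 1, 1], a]"

lemma framed_nth [simp]:
  "framed a $ 1 = vector [1, 0, 0]" "framed a $ 2 = vector [0, 1, 0]" "framed a $ 3 = vector [0, 0, 1]"
  "framed a $ 4 = vector [1, 1, 1]" "framed a $ 5 = a"
  by (simp_all add: framed_def)

text \<open>Equivalently, no three of the five points \<open>framed a\<close> are on a line.\<close>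

definition generic_coords :: "complex ^ 3 \<Rightarrow> bool" where
  "generic_coords a \<longleftrightarrow> a$1 \<noteq> 0 \<and> a$2 \<noteq> 0 \<and> a$3 \<noteq> 0 \<and> a$1 \<noteq> a$2 \<and> a$1 \<noteq> a$3 \<and> a$2 \<noteq> a$3"

text \<open>The denominators of the formula for the sixth pair. Up to sign they are the entries of the
  cross product of \<open>a\<close> and \<open>b\<close>.\<close>

definition den1 :: "complex ^ 3 \<Rightarrow> complex ^ 3 \<Rightarrow> complex" where
  "den1 a b = b$3 * a$2 - a$3 * b$2"

definition den2 :: "complex ^ 3 \<Rightarrow> complex ^ 3 \<Rightarrow> complex" where
  "den2 a b = b$3 * a$1 - a$3 * b$1"

definition den3 :: "complex ^ 3 \<Rightarrow> complex ^ 3 \<Rightarrow> complex" where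
  "den3 a b = b$1 * a$2 - a$1 * b$2"

text \<open>The bracket of \<open>(1,1,1)\<close>, \<open>a\<close> and \<open>b\<close>.\<close>

definition lin_det :: "complex ^ 3 \<Rightarrow> complex ^ 3 \<Rightarrow> complex" where
  "lin_det a b = a$1 * b$2 + a$2 * b$3 + a$3 * b$1 - a$2 * b$1 - a$3 * b$2 - a$1 * b$3"

text \<open>The expression \<open>lin_det\<close> of the coordinatewise inverses of \<open>a\<close> and \<open>b\<close>, multiplied by all six
  coordinates. Inverting the coordinates is the standard Cremona transformation; it exchanges \<open>s\<close> and
  \<open>t\<close> in \<open>s + t a\<^sub>i b\<^sub>j\<close> if this entry is divided by \<open>a\<^sub>i b\<^sub>j\<close>.\<close>

definition cremona_det :: "complex ^ 3 \<Rightarrow> complex ^ 3 \<Rightarrow> complex" where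
  "cremona_det a b =
     a$1 * b$2 * (a$2 * b$3) + a$2 * b$3 * (a$3 * b$1) + a$3 * b$1 * (a$1 * b$2)
   - a$2 * b$1 * (a$3 * b$2) - a$3 * b$2 * (a$1 * b$3) - a$1 * b$3 * (a$2 * b$1)"

lemmas dens = den1_def den2_def den3_def

text \<open>The off-diagonal entries of the matrix in the span of \<open>(1,1,1)(1,1,1)\<^sup>T\<close> and \<open>a b\<^sup>T\<close> that belongs to
  the sixth pair. Each is, up to the common factor \<open>den1 a b * den2 a b * den3 a b\<close>, an entry of a
  product \<open>p q\<^sup>T\<close>, and the two vectors \<open>p\<close> and \<open>q\<close> can be read off: this is the origin of the formula
  for the sixth pair.\<close>

lemma off_diagonal_factorization:
  "cremona_det a b - lin_det a b * (a$1 * b$2) = (b$3 - b$2) * (a$3 - a$1) * den3 a b"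
  "cremona_det a b - lin_det a b * (a$2 * b$1) = (b$3 - b$1) * (a$3 - a$2) * den3 a b"
  "cremona_det a b - lin_det a b * (a$1 * b$3) = (b$3 - b$2) * (a$1 - a$2) * den2 a b"
  "cremona_det a b - lin_det a b * (a$3 * b$1) = (b$1 - b$2) * (a$3 - a$2) * den2 a b"
  "cremona_det a b - lin_det a b * (a$2 * b$3) = (b$3 - b$1) * (a$1 - a$2) * den1 a b"
  "cremona_det a b - lin_det a b * (a$3 * b$2) = (b$1 - b$2) * (a$3 - a$1) * den1 a b"
  unfolding cremona_det_def lin_det_def dens by algebra+

text \<open>For each of the five given pairs, coincidence of the sixth pair with it is expressed by the
  vanishing of one of five polynomials.\<close>

lemma pencil_gap_framed:
  "pencil_gap (framed a) (framed b) 1 2 3 4 5 = 0 \<longleftrightarrow> den1 a b = 0"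
  "pencil_gap (framed a) (framed b) 2 1 3 4 5 = 0 \<longleftrightarrow> den2 a b = 0"
  "pencil_gap (framed a) (framed b) 3 1 2 4 5 = 0 \<longleftrightarrow> den3 a b = 0"
  "pencil_gap (framed a) (framed b) 4 1 2 3 5 = 0 \<longleftrightarrow> lin_det a b = 0"
  "pencil_gap (framed a) (framed b) 5 1 2 3 4 = 0 \<longleftrightarrow> cremona_det a b = 0"
proof -
  have g: "pencil_gap (framed a) (framed b) 1 2 3 4 5 = den1 a b"
    "pencil_gap (framed a) (framed b) 2 1 3 4 5 = den2 a b"
    "pencil_gap (framed a) (framed b) 3 1 2 4 5 = - den3 a b"
    "pencil_gap (framed a) (framed b) 4 1 2 3 5 = lin_det a b"
    "pencil_gap (framed a) (framed b) 5 1 2 3 4 = cremona_det a b"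
    unfolding pencil_gap_def bracket_expand dens lin_det_def cremona_det_def framed_nth vector_3
    by algebra+
  show "pencil_gap (framed a) (framed b) 1 2 3 4 5 = 0 \<longleftrightarrow> den1 a b = 0"
  "pencil_gap (framed a) (framed b) 2 1 3 4 5 = 0 \<longleftrightarrow> den2 a b = 0"
  "pencil_gap (framed a) (framed b) 3 1 2 4 5 = 0 \<longleftrightarrow> den3 a b = 0"
  "pencil_gap (framed a) (framed b) 4 1 2 3 5 = 0 \<longleftrightarrow> lin_det a b = 0"
  "pencil_gap (framed a) (framed b) 5 1 2 3 4 = 0 \<longleftrightarrow> cremona_det a b = 0"
    unfolding g by simp_all
qed

text \<open>The first three pairs contribute exactly the diagonal matrices to the span. Thus only the six
  off-diagonal entries matter, and these involve only the other three pairs.\<close>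

lemma rank_framed_less_iff:
  "rank (pair_matrix (adjoin_sixth (framed a) p) (adjoin_sixth (framed b) q)) < 6 \<longleftrightarrow>
    (\<exists>r s t. (r \<noteq> 0 \<or> s \<noteq> 0 \<or> t \<noteq> 0) \<and>
       (\<forall>i j. i \<noteq> j \<longrightarrow> r * (p$i * q$j) = s + t * (a$i * b$j)))" (is "?L \<longleftrightarrow> ?R")
proof -
  have L: "?L \<longleftrightarrow> (\<exists>c :: 6 \<Rightarrow> complex. (\<exists>i. c i \<noteq> 0) \<and> (\<forall>j k.
     (\<Sum>i\<in>UNIV. c i * (adjoin_sixth (framed a) p $ i $ j * adjoin_sixth (framed b) q $ i $ k)) = 0))"
    using rank_pair_matrix_less_iff[of "adjoin_sixth (framed a) p" "adjoin_sixth (framed b) q"] by simp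
  show ?thesis
  proof
    assume ?L
    then obtain c :: "6 \<Rightarrow> complex" where c: "\<exists>i. c i \<noteq> 0"
      "\<forall>j k. (\<Sum>i\<in>UNIV. c i * (adjoin_sixth (framed a) p $ i $ j * adjoin_sixth (framed b) q $ i $ k)) = 0"
      unfolding L by auto
    have entry: "(\<Sum>i\<in>UNIV. c i * (adjoin_sixth (framed a) p $ i $ j * adjoin_sixth (framed b) q $ i $ k)) = 0" for j k
      using c(2) by blast
    have "c 6 \<noteq> 0 \<or> c 4 \<noteq> 0 \<or> c 5 \<noteq> 0"
    proof (rule ccontr)
      assume z: "\<not> ?thesis"
      then have "c 1 = 0" "c 2 = 0" "c 3 = 0"
        using entry[of 1 1] entry[of 2 2] entry[of 3 3] by (simp_all add: sum_6)
      moreover obtain i where "c i \<noteq> 0"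
        using c(1) by blast
      ultimately show False
        using z exhaust_6[of i] by auto
    qed
    moreover have "c 6 * (p$i * q$j) = (- c 4) + (- c 5) * (a$i * b$j)" if "i \<noteq> j" for i j
    proof -
      have "c 4 + c 5 * (a$i * b$j) + c 6 * (p$i * q$j) = 0"
        using entry[of i j] that exhaust_3[of i] exhaust_3[of j] by (auto simp: sum_6)
      then show ?thesis by algebra
    qed
    ultimately show ?R
      by (intro exI[of _ "c 6"] exI[of _ "- c 4"] exI[of _ "- c 5"]) simp
  next
    assume ?R
    then obtain r s t where nz: "r \<noteq> 0 \<or> s \<noteq> 0 \<or> t \<noteq> 0"
      and off: "\<forall>i j. i \<noteq> j \<longrightarrow> r * (p$i * q$j) = s + t * (a$i * b$j)" by auto
    \<comment> \<open>The first three pairs adjust the diagonal.\<close>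
    define d where "d i = s + t * (a$i * b$i) - r * (p$i * q$i)" for i
    define c :: "6 \<Rightarrow> complex" where "c i = (if i = 1 then d 1 else if i = 2 then d 2 else if i = 3 then d 3
       else if i = 4 then - s else if i = 5 then - t else r)" for i
    have cv: "c 1 = d 1" "c 2 = d 2" "c 3 = d 3" "c 4 = - s" "c 5 = - t" "c 6 = r"
      by (simp_all add: c_def)
    have "\<exists>i. c i \<noteq> 0"
    proof -
      have "c 6 \<noteq> 0 \<or> c 4 \<noteq> 0 \<or> c 5 \<noteq> 0"
        using nz by (simp add: cv)
      then show ?thesis by blast
    qed
    moreover have "\<forall>j k. (\<Sum>i\<in>UNIV. c i * (adjoin_sixth (framed a) p $ i $ j * adjoin_sixth (framed b) q $ i $ k)) = 0"
      using off by (simp add: sum_6 forall_3 cv d_def)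
    ultimately show ?L unfolding L by (intro exI[of _ c] conjI)
  qed
qed

section \<open>The sixth pair in normal form\<close>

text \<open>For \<open>c = b\<close> this is the first point of the sixth pair, for \<open>c = a\<close> the second one.\<close>

definition frame_sixth :: "complex ^ 3 \<Rightarrow> complex ^ 3 \<Rightarrow> complex ^ 3 \<Rightarrow> complex ^ 3" where
  "frame_sixth c a b = vector
     [(c$3 - c$2) / den1 a b, (c$3 - c$1) / den2 a b, (c$1 - c$2) / den3 a b]"

lemma proportional_if_dens_zero:
  assumes a: "generic_coords a" and "den1 a b = 0" "den2 a b = 0"
  shows "b = (b$3 / a$3) *s a"
  using assms by (simp add: vec_eq_iff forall_3 generic_coords_def dens field_simps)

text \<open>The cross product of \<open>a\<close> and \<open>b\<close> is orthogonal to \<open>a\<close>.\<close>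

lemma dens_dependent: "a$1 * den1 a b = a$2 * den2 a b + a$3 * den3 a b"
  unfolding dens by algebra

lemma proj_eq_if_minors_zero:
  assumes "q$1 \<noteq> 0" "p \<noteq> 0" "p$1 * q$2 = p$2 * q$1" "p$1 * q$3 = p$3 * q$1"
  shows "proj_eq p q"
proof -
  have "p = (p$1 / q$1) *s q"
    using assms by (simp add: vec_eq_iff forall_3 field_simps)
  moreover have "q \<noteq> 0" using assms(1) by auto
  ultimately show ?thesis using assms(2) unfolding proj_eq_def by blast
qed

text \<open>The off-diagonal entries of a rank-one matrix satisfy
  \<open>m\<^sub>1\<^sub>2 m\<^sub>2\<^sub>3 m\<^sub>3\<^sub>1 = m\<^sub>2\<^sub>1 m\<^sub>3\<^sub>2 m\<^sub>1\<^sub>3\<close>. For \<open>m\<^sub>i\<^sub>j = s + t a\<^sub>i b\<^sub>j\<close> the cubes of \<open>s\<close> and of \<open>t\<close> cancel in this cubic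
  equation, and what remains beside the trivial factors \<open>s\<close> and \<open>t\<close> is one linear equation, whose
  coefficients are \<open>lin_det a b\<close> and \<open>cremona_det a b\<close>. They cannot both vanish, because \<open>a\<close> and \<open>b\<close> are
  different points. So \<open>(s : t)\<close> is determined, and by the factorization so are the entries. If one of
  the coordinates of \<open>p\<close> and \<open>q\<close> were zero, two entries in a row or column and hence two of the
  denominators would vanish, and then \<open>a\<close> and \<open>b\<close> would coincide. So all coordinates are nonzero and
  their ratios are ratios of entries.\<close>

lemma frame_solution:
  assumes a: "generic_coords a" and b: "generic_coords b" and ab: "\<And>c. b \<noteq> c *s a"
    and s: "s \<noteq> 0" and t: "t \<noteq> 0"
    and pq: "\<And>i j. i \<noteq> j \<Longrightarrow> p$i * q$j = s + t * (a$i * b$j)"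
  shows "lin_det a b \<noteq> 0" "cremona_det a b \<noteq> 0" "den1 a b \<noteq> 0" "den2 a b \<noteq> 0" "den3 a b \<noteq> 0"
    "proj_eq p (frame_sixth b a b)" "proj_eq q (frame_sixth a a b)"
proof -
  let ?A = "lin_det a b" and ?B = "cremona_det a b"
  note gen = a[unfolded generic_coords_def] b[unfolded generic_coords_def]
  have e: "p$1 * q$2 = s + t * (a$1 * b$2)" "p$2 * q$1 = s + t * (a$2 * b$1)"
    "p$1 * q$3 = s + t * (a$1 * b$3)" "p$3 * q$1 = s + t * (a$3 * b$1)"
    "p$2 * q$3 = s + t * (a$2 * b$3)" "p$3 * q$2 = s + t * (a$3 * b$2)"
    by (rule pq; simp)+
  \<comment> \<open>A cubic relation between the off-diagonal entries of a rank-one matrix.\<close>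
  have "(p$1 * q$2) * (p$2 * q$3) * (p$3 * q$1) = (p$2 * q$1) * (p$3 * q$2) * (p$1 * q$3)"
    by algebra
  then have "s * t * (s * ?A + t * ?B) = 0"
    unfolding e lin_det_def cremona_det_def by algebra
  then have st: "s * ?A + t * ?B = 0"
    using s t by simp
  have nonprop: "den1 a b \<noteq> 0 \<or> den2 a b \<noteq> 0"
    using proportional_if_dens_zero[OF a, of b] ab by blast
  have "?A \<noteq> 0"
  proof
    assume A: "?A = 0"
    then have B: "?B = 0" using st t by simp
    have "den1 a b = 0" "den2 a b = 0"
      using off_diagonal_factorization(3,5)[of a b] A B gen by auto
    with nonprop show False by blast
  qed
  moreover have "?B \<noteq> 0"
    using st s \<open>?A \<noteq> 0\<close> by auto
  ultimately show AB: "?A \<noteq> 0" "?B \<noteq> 0" by auto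
  have off: "p$i * q$j * ?A = - t * (?B - ?A * (a$i * b$j))" if "i \<noteq> j" for i j
    unfolding pq[OF that] using st by algebra
  have m: "p$1 * q$2 * ?A = - t * ((b$3 - b$2) * (a$3 - a$1) * den3 a b)"
    "p$2 * q$1 * ?A = - t * ((b$3 - b$1) * (a$3 - a$2) * den3 a b)"
    "p$1 * q$3 * ?A = - t * ((b$3 - b$2) * (a$1 - a$2) * den2 a b)"
    "p$3 * q$1 * ?A = - t * ((b$1 - b$2) * (a$3 - a$2) * den2 a b)"
    "p$2 * q$3 * ?A = - t * ((b$3 - b$1) * (a$1 - a$2) * den1 a b)"
    "p$3 * q$2 * ?A = - t * ((b$1 - b$2) * (a$3 - a$1) * den1 a b)"
    using off[of 1 2] off[of 2 1] off[of 1 3] off[of 3 1] off[of 2 3] off[of 3 2]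
    unfolding off_diagonal_factorization by simp_all
  have "p$1 = 0 \<Longrightarrow> den3 a b = 0 \<and> den2 a b = 0" "q$1 = 0 \<Longrightarrow> den3 a b = 0 \<and> den2 a b = 0"
    "p$2 = 0 \<Longrightarrow> den3 a b = 0 \<and> den1 a b = 0" "q$2 = 0 \<Longrightarrow> den3 a b = 0 \<and> den1 a b = 0"
    "p$3 = 0 \<Longrightarrow> den2 a b = 0 \<and> den1 a b = 0" "q$3 = 0 \<Longrightarrow> den2 a b = 0 \<and> den1 a b = 0"
    using m gen t by auto
  then have nz: "p$1 \<noteq> 0" "p$2 \<noteq> 0" "p$3 \<noteq> 0" "q$1 \<noteq> 0" "q$2 \<noteq> 0" "q$3 \<noteq> 0"
    using nonprop dens_dependent[of a b] gen by auto
  show d: "den1 a b \<noteq> 0" "den2 a b \<noteq> 0" "den3 a b \<noteq> 0"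
    using m nz AB by auto
  define P where "P = frame_sixth b a b"
  define Q where "Q = frame_sixth a a b"
  have P: "P$1 * den1 a b = b$3 - b$2" "P$2 * den2 a b = b$3 - b$1" "P$3 * den3 a b = b$1 - b$2"
    and Q: "Q$1 * den1 a b = a$3 - a$2" "Q$2 * den2 a b = a$3 - a$1" "Q$3 * den3 a b = a$1 - a$2"
    using d by (simp_all add: P_def Q_def frame_sixth_def)
  have PQ1: "P$1 \<noteq> 0" "Q$1 \<noteq> 0"
    using P Q gen by auto
  \<comment> \<open>The scalar between the off-diagonal parts of \<open>p q\<^sup>T\<close> and \<open>P Q\<^sup>T\<close>, by the factorization.\<close>
  define z where "z = - t * den1 a b * den2 a b * den3 a b / ?A"
  have z: "z \<noteq> 0" using t d AB by (simp add: z_def)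
  have prod: "p$1 * q$2 = z * (P$1 * Q$2)" "p$2 * q$1 = z * (P$2 * Q$1)"
    "p$1 * q$3 = z * (P$1 * Q$3)" "p$3 * q$1 = z * (P$3 * Q$1)"
    "p$2 * q$3 = z * (P$2 * Q$3)" "p$3 * q$2 = z * (P$3 * Q$2)"
    using m AB(1) unfolding z_def P[symmetric] Q[symmetric] by (simp_all add: field_simps)
  have "p$1 * P$2 = p$2 * P$1"
  proof -
    have "q$3 * Q$3 * (p$1 * P$2) * z = q$3 * Q$3 * (p$2 * P$1) * z"
      using prod(3,5) by algebra
    moreover have "Q$3 \<noteq> 0" using Q gen by auto
    ultimately show ?thesis using nz z by simp
  qed
  moreover have "p$1 * P$3 = p$3 * P$1"
  proof -
    have "q$2 * Q$2 * (p$1 * P$3) * z = q$2 * Q$2 * (p$3 * P$1) * z"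
      using prod(1,6) by algebra
    moreover have "Q$2 \<noteq> 0" using Q gen by auto
    ultimately show ?thesis using nz z by simp
  qed
  ultimately show "proj_eq p (frame_sixth b a b)"
    using nz PQ1 unfolding P_def[symmetric] by (intro proj_eq_if_minors_zero) auto
  have "q$1 * Q$2 = q$2 * Q$1"
  proof -
    have "p$3 * P$3 * (q$1 * Q$2) * z = p$3 * P$3 * (q$2 * Q$1) * z"
      using prod(4,6) by algebra
    moreover have "P$3 \<noteq> 0" using P gen by auto
    ultimately show ?thesis using nz z by simp
  qed
  moreover have "q$1 * Q$3 = q$3 * Q$1"
  proof -
    have "p$2 * P$2 * (q$1 * Q$3) * z = p$2 * P$2 * (q$3 * Q$1) * z"
      using prod(2,5) by algebra
    moreover have "P$2 \<noteq> 0" using P gen by auto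
    ultimately show ?thesis using nz z by simp
  qed
  ultimately show "proj_eq q (frame_sixth a a b)"
    using nz PQ1 unfolding Q_def[symmetric] by (intro proj_eq_if_minors_zero) auto
qed

text \<open>A solution in which \<open>s\<close> or \<open>t\<close> vanishes is one of the given pairs: a diagonal matrix of rank one
  gives one of the first three, \<open>t = 0\<close> the fourth and \<open>s = 0\<close> the fifth.\<close>

lemma new_sixth_pair_framed:
  assumes a: "generic_coords a" and b: "generic_coords b" and ab: "\<And>c. b \<noteq> c *s a"
    and new: "new_sixth_pair (framed a) (framed b) p q"
  shows "lin_det a b \<noteq> 0" "cremona_det a b \<noteq> 0" "den1 a b \<noteq> 0" "den2 a b \<noteq> 0" "den3 a b \<noteq> 0"
    "proj_eq p (frame_sixth b a b)" "proj_eq q (frame_sixth a a b)"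
proof -
  note gen = a[unfolded generic_coords_def] b[unfolded generic_coords_def]
  have nz: "p \<noteq> 0" "q \<noteq> 0"
    and old: "\<And>i. \<not> (proj_eq p (framed a $ i) \<and> proj_eq q (framed b $ i))"
    and rank: "rank (pair_matrix (adjoin_sixth (framed a) p) (adjoin_sixth (framed b) q)) < 6"
    using new by (auto simp: new_sixth_pair_def)
  obtain r s t where rst: "r \<noteq> 0 \<or> s \<noteq> 0 \<or> t \<noteq> 0"
    and eq: "\<And>i j. i \<noteq> j \<Longrightarrow> r * (p$i * q$j) = s + t * (a$i * b$j)"
    using rank unfolding rank_framed_less_iff by (elim exE conjE) (rule that; blast)
  have "r \<noteq> 0"
  proof
    assume r: "r = 0"
    have "s + t * (a$1 * b$3) = 0" "s + t * (a$2 * b$3) = 0"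
      using eq[of 1 3] eq[of 2 3] r by simp_all
    then have "t * (b$3 * (a$1 - a$2)) = 0" by algebra
    then have "t = 0" using gen by auto
    moreover from this have "s = 0" using eq[of 1 3] r by simp
    ultimately show False using rst r by simp
  qed
  define s' where "s' = s / r"
  define t' where "t' = t / r"
  have pq: "p$i * q$j = s' + t' * (a$i * b$j)" if "i \<noteq> j" for i j
    using eq[OF that] \<open>r \<noteq> 0\<close> by (simp add: s'_def t'_def field_simps)
  have e: "p$1 * q$2 = s' + t' * (a$1 * b$2)" "p$2 * q$1 = s' + t' * (a$2 * b$1)"
    "p$1 * q$3 = s' + t' * (a$1 * b$3)" "p$3 * q$1 = s' + t' * (a$3 * b$1)"
    "p$2 * q$3 = s' + t' * (a$2 * b$3)" "p$3 * q$2 = s' + t' * (a$3 * b$2)"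
    by (rule pq; simp)+
  have one_nz: "vector [1, 0, 0] \<noteq> (0::complex^3)" "vector [0, 1, 0] \<noteq> (0::complex^3)" "vector [0, 0, 1] \<noteq> (0::complex^3)"
    by (simp_all add: vec_eq_iff forall_3)
  have "s' \<noteq> 0 \<or> t' \<noteq> 0"
  proof (rule ccontr)
    assume "\<not> ?thesis"
    then have z: "p$i * q$j = 0" if "i \<noteq> j" for i j
      using pq[OF that] by simp
    have "\<exists>i. p$i \<noteq> 0" using nz(1) by (auto simp: vec_eq_iff)
    then obtain i where i: "p$i \<noteq> 0" by blast
    then have qz: "q$j = 0" if "j \<noteq> i" for j using z[of i j] that by auto
    have "q$i \<noteq> 0"
    proof
      assume "q$i = 0"
      then have "q$j = 0" for j using qz by (cases "j = i") simp_all
      then show False using nz(2) by (simp add: vec_eq_iff)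
    qed
    then have pz: "p$j = 0" if "j \<noteq> i" for j using z[of j i] that by auto
    consider "i = 1" | "i = 2" | "i = 3" using exhaust_3[of i] by blast
    then show False
    proof cases
      case 1
      have "p = p$1 *s vector [1, 0, 0]" "q = q$1 *s vector [1, 0, 0]"
        using 1 qz pz by (simp_all add: vec_eq_iff forall_3)
      then have "proj_eq p (framed a $ 1) \<and> proj_eq q (framed b $ 1)"
        using nz one_nz unfolding proj_eq_def framed_nth by blast
      with old show False by blast
    next
      case 2
      have "p = p$2 *s vector [0, 1, 0]" "q = q$2 *s vector [0, 1, 0]"
        using 2 qz pz by (simp_all add: vec_eq_iff forall_3)
      then have "proj_eq p (framed a $ 2) \<and> proj_eq q (framed b $ 2)"
        using nz one_nz unfolding proj_eq_def framed_nth by blast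
      with old show False by blast
    next
      case 3
      have "p = p$3 *s vector [0, 0, 1]" "q = q$3 *s vector [0, 0, 1]"
        using 3 qz pz by (simp_all add: vec_eq_iff forall_3)
      then have "proj_eq p (framed a $ 3) \<and> proj_eq q (framed b $ 3)"
        using nz one_nz unfolding proj_eq_def framed_nth by blast
      with old show False by blast
    qed
  qed
  have "t' \<noteq> 0"
  proof
    assume t: "t' = 0"
    then have "s' \<noteq> 0" using \<open>s' \<noteq> 0 \<or> t' \<noteq> 0\<close> by simp
    have pq0: "p$1 \<noteq> 0" "p$2 \<noteq> 0" "p$3 \<noteq> 0" "q$1 \<noteq> 0" "q$2 \<noteq> 0" "q$3 \<noteq> 0"
      using e \<open>s' \<noteq> 0\<close> t by auto
    have "p$1 * q$3 = p$2 * q$3" "p$1 * q$2 = p$3 * q$2" "p$3 * q$1 = p$3 * q$2" "p$2 * q$1 = p$2 * q$3"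
      using e t by simp_all
    then have "p$1 = p$2" "p$1 = p$3" "q$1 = q$2" "q$1 = q$3"
      using pq0 by simp_all
    then have "proj_eq p (framed a $ 4)" "proj_eq q (framed b $ 4)"
      unfolding framed_nth by (intro proj_eq_if_minors_zero nz; simp)+
    with old show False by blast
  qed
  moreover have "s' \<noteq> 0"
  proof
    assume s: "s' = 0"
    have pq0: "p$1 \<noteq> 0" "p$2 \<noteq> 0" "p$3 \<noteq> 0" "q$1 \<noteq> 0" "q$2 \<noteq> 0" "q$3 \<noteq> 0"
      using e \<open>t' \<noteq> 0\<close> s gen by auto
    have "q$3 * (p$1 * a$2) = q$3 * (p$2 * a$1)"
      using e(3,5) unfolding s by algebra
    moreover have "q$2 * (p$1 * a$3) = q$2 * (p$3 * a$1)"
      using e(1,6) unfolding s by algebra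
    moreover have "p$3 * (q$1 * b$2) = p$3 * (q$2 * b$1)"
      using e(4,6) unfolding s by algebra
    moreover have "p$2 * (q$1 * b$3) = p$2 * (q$3 * b$1)"
      using e(2,5) unfolding s by algebra
    ultimately have "p$1 * a$2 = p$2 * a$1" "p$1 * a$3 = p$3 * a$1" "q$1 * b$2 = q$2 * b$1" "q$1 * b$3 = q$3 * b$1"
      using pq0 by simp_all
    then have "proj_eq p (framed a $ 5)" "proj_eq q (framed b $ 5)"
      unfolding framed_nth using gen by (intro proj_eq_if_minors_zero nz; simp)+
    with old show False by blast
  qed
  ultimately have st: "s' \<noteq> 0" "t' \<noteq> 0" by auto
  show "lin_det a b \<noteq> 0" "cremona_det a b \<noteq> 0" "den1 a b \<noteq> 0" "den2 a b \<noteq> 0" "den3 a b \<noteq> 0"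
    "proj_eq p (frame_sixth b a b)" "proj_eq q (frame_sixth a a b)"
    by (rule frame_solution[OF a b ab st pq], assumption)+
qed

text \<open>The factorization shows that the off-diagonal entries are in the span. No coordinate of the two
  points is zero, so the pair is none of the first three; coincidence with the fourth or the fifth pair
  would make \<open>lin_det a b\<close> or \<open>cremona_det a b\<close> vanish.\<close>

lemma new_sixth_pair_frame_sixth:
  assumes a: "generic_coords a" and b: "generic_coords b"
    and A: "lin_det a b \<noteq> 0" and B: "cremona_det a b \<noteq> 0"
    and d: "den1 a b \<noteq> 0" "den2 a b \<noteq> 0" "den3 a b \<noteq> 0"
  shows "new_sixth_pair (framed a) (framed b) (frame_sixth b a b) (frame_sixth a a b)"
proof -
  note gen = a[unfolded generic_coords_def] b[unfolded generic_coords_def]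
  define P where "P = frame_sixth b a b"
  define Q where "Q = frame_sixth a a b"
  define z where "z = den1 a b * den2 a b * den3 a b"
  have P: "P$1 * den1 a b = b$3 - b$2" "P$2 * den2 a b = b$3 - b$1" "P$3 * den3 a b = b$1 - b$2"
    and Q: "Q$1 * den1 a b = a$3 - a$2" "Q$2 * den2 a b = a$3 - a$1" "Q$3 * den3 a b = a$1 - a$2"
    using d by (simp_all add: P_def Q_def frame_sixth_def)
  have nz: "P$1 \<noteq> 0" "P$2 \<noteq> 0" "P$3 \<noteq> 0" "Q$1 \<noteq> 0" "Q$2 \<noteq> 0" "Q$3 \<noteq> 0"
    using P Q gen by auto
  have z: "z \<noteq> 0" using d by (simp add: z_def)
  have e: "z * (P$1 * Q$2) = cremona_det a b + (- lin_det a b) * (a$1 * b$2)"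
    "z * (P$2 * Q$1) = cremona_det a b + (- lin_det a b) * (a$2 * b$1)"
    "z * (P$1 * Q$3) = cremona_det a b + (- lin_det a b) * (a$1 * b$3)"
    "z * (P$3 * Q$1) = cremona_det a b + (- lin_det a b) * (a$3 * b$1)"
    "z * (P$2 * Q$3) = cremona_det a b + (- lin_det a b) * (a$2 * b$3)"
    "z * (P$3 * Q$2) = cremona_det a b + (- lin_det a b) * (a$3 * b$2)"
    using off_diagonal_factorization[of a b] unfolding z_def P[symmetric] Q[symmetric]
    by (simp_all add: algebra_simps)
  then have "\<forall>i j. i \<noteq> j \<longrightarrow> z * (P$i * Q$j) = cremona_det a b + (- lin_det a b) * (a$i * b$j)"
    by (simp add: forall_3)
  then have "rank (pair_matrix (adjoin_sixth (framed a) P) (adjoin_sixth (framed b) Q)) < 6"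
    unfolding rank_framed_less_iff using z by blast
  moreover have "\<not> (proj_eq P (framed a $ i) \<and> proj_eq Q (framed b $ i))" for i
  proof -
    have unit: "\<not> proj_eq P (vector [1, 0, 0])" "\<not> proj_eq P (vector [0, 1, 0])" "\<not> proj_eq P (vector [0, 0, 1])"
      using nz by (auto simp: proj_eq_def vec_eq_iff[of P] forall_3)
    have ones: False if P1: "proj_eq P (vector [1, 1, 1])" and Q1: "proj_eq Q (vector [1, 1, 1])"
    proof -
      have "P$1 * Q$2 = P$1 * Q$3"
        using Q1 by (auto simp: proj_eq_def)
      then have "lin_det a b * (a$1 * (b$2 - b$3)) = 0"
        using e(1,3) by algebra
      then show False using A gen by auto
    qed
    have fifth: False if Pa: "proj_eq P a" and Qb: "proj_eq Q b"
    proof -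
      obtain c where "P = c *s a" using Pa by (auto simp: proj_eq_def)
      moreover obtain d where "Q = d *s b" using Qb by (auto simp: proj_eq_def)
      ultimately have "z * (c * a$1 * (d * b$2)) = cremona_det a b + (- lin_det a b) * (a$1 * b$2)"
        "z * (c * a$1 * (d * b$3)) = cremona_det a b + (- lin_det a b) * (a$1 * b$3)"
        using e(1,3) by simp_all
      then have "cremona_det a b * (b$2 - b$3) = 0"
        by algebra
      then show False using B gen by auto
    qed
    show ?thesis
      by (cases i rule: cases_5) (use unit ones fifth in auto)
  qed
  moreover have "P \<noteq> 0" "Q \<noteq> 0" using nz by auto
  ultimately show ?thesis
    unfolding new_sixth_pair_def P_def Q_def by blast
qed

lemma no_equal_pencils_framed_iff:
  assumes "\<And>i j k. distinct [i, j, k] \<Longrightarrow> bracket (framed a $ i) (framed a $ j) (framed a $ k) \<noteq> 0"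
    and "\<And>i j k. distinct [i, j, k] \<Longrightarrow> bracket (framed b $ i) (framed b $ j) (framed b $ k) \<noteq> 0"
  shows "no_equal_pencils (framed a) (framed b) \<longleftrightarrow>
    lin_det a b \<noteq> 0 \<and> cremona_det a b \<noteq> 0 \<and> den1 a b \<noteq> 0 \<and> den2 a b \<noteq> 0 \<and> den3 a b \<noteq> 0"
  using no_equal_pencils_iff_pencil_gap[OF assms] unfolding pencil_gap_framed by blast

lemma generic_coords_if_brackets:
  assumes "\<And>i j k. distinct [i, j, k] \<Longrightarrow> bracket (framed a $ i) (framed a $ j) (framed a $ k) \<noteq> 0"
  shows "generic_coords a"
  using assms[of 2 3 5] assms[of 1 3 5] assms[of 1 2 5] assms[of 1 4 5] assms[of 2 4 5] assms[of 3 4 5]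
  by (auto simp: generic_coords_def bracket_expand)

section \<open>Moving the first four points to the standard frame\<close>

lemma fixes_first_four_imp_moves:
  assumes "fixes_first_four H x" "x $ 5 \<noteq> 0"
  shows "moves H x (framed (H *v (x $ 5)))"
proof -
  have "proj_eq (H *v (x $ 5)) (H *v (x $ 5))"
    using assms proj_eq_smult[of 1 "H *v (x $ 5)"]
    by (simp add: fixes_first_four_def invertible_mult_zero_iff)
  then show ?thesis
    using assms by (simp add: moves_def forall_5 fixes_first_four_def standard_frame_def)
qed

text \<open>Cramer's rule for the coordinates with respect to the frame \<open>x\<^sub>1, x\<^sub>2, x\<^sub>3, x\<^sub>4\<close>, where \<open>x\<^sub>4\<close> gets
  equal coordinates. All denominators are cleared, so that the coordinates are polynomials in the
  given points.\<close>

definition frame_coords :: "complex ^ 3 ^ 5 \<Rightarrow> complex ^ 3 \<Rightarrow> complex ^ 3" where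
  "frame_coords x v = vector
    [bracket v (x$2) (x$3) * (bracket (x$1) (x$4) (x$3) * bracket (x$1) (x$2) (x$4)),
     bracket (x$1) v (x$3) * (bracket (x$4) (x$2) (x$3) * bracket (x$1) (x$2) (x$4)),
     bracket (x$1) (x$2) v * (bracket (x$4) (x$2) (x$3) * bracket (x$1) (x$4) (x$3))]"

text \<open>The inverse of \<open>frame_coords\<close> up to a scalar factor, again without denominators.\<close>

definition frame_combination :: "complex ^ 3 ^ 5 \<Rightarrow> complex ^ 3 \<Rightarrow> complex ^ 3" where
  "frame_combination x w =
     (bracket (x$4) (x$2) (x$3) * w$1) *s x$1 + (bracket (x$1) (x$4) (x$3) * w$2) *s x$2 +
     (bracket (x$1) (x$2) (x$4) * w$3) *s x$3"

definition frame_matrix :: "complex ^ 3 ^ 5 \<Rightarrow> complex ^ 3 ^ 3" where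
  "frame_matrix x = matrix (frame_coords x)"

lemma bracket_zero_repeated [simp]: "bracket p p q = 0" "bracket p q p = 0" "bracket q p p = 0"
  by (simp_all add: bracket_expand)

lemma frame_matrix_mult: "frame_matrix x *v v = frame_coords x v"
proof -
  have add: "bracket (p + p') q r = bracket p q r + bracket p' q r"
    "bracket q (p + p') r = bracket q p r + bracket q p' r"
    "bracket q r (p + p') = bracket q r p + bracket q r p'" for p p' q r
    by (simp_all add: bracket_expand algebra_simps)
  have smult: "bracket (c *s p) q r = c * bracket p q r" "bracket q (c *s p) r = c * bracket q p r"
    "bracket q r (c *s p) = c * bracket q r p" for c p q r
    by (simp_all add: bracket_expand algebra_simps)
  have "Vector_Spaces.linear (*s) (*s) (frame_coords x)"
    by unfold_locales
      (simp_all add: vec_eq_iff forall_3 frame_coords_def add smult algebra_simps)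
  then show ?thesis
    unfolding frame_matrix_def by (rule matrix_works)
qed

lemma frame_coords_combination:
  "frame_coords x (frame_combination x w) =
    (bracket (x$1) (x$2) (x$3) * bracket (x$4) (x$2) (x$3) * bracket (x$1) (x$4) (x$3) *
      bracket (x$1) (x$2) (x$4)) *s w"
proof -
  have "bracket (frame_combination x w) (x$2) (x$3) = bracket (x$4) (x$2) (x$3) * w$1 * bracket (x$1) (x$2) (x$3)"
    "bracket (x$1) (frame_combination x w) (x$3) = bracket (x$1) (x$4) (x$3) * w$2 * bracket (x$1) (x$2) (x$3)"
    "bracket (x$1) (x$2) (frame_combination x w) = bracket (x$1) (x$2) (x$4) * w$3 * bracket (x$1) (x$2) (x$3)"
    unfolding bracket_expand frame_combination_def vector_add_component vector_smult_component by algebra+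
  then show ?thesis
    by (simp add: vec_eq_iff forall_3 frame_coords_def)
qed

lemma invertible_frame_matrix:
  assumes gp: "points_general_position x"
  shows "invertible (frame_matrix x)"
proof -
  note br = bracket_nonzero_if_general_position[OF gp]
  have "\<exists>v. w = frame_matrix x *v v" for w
  proof -
    define D where "D = bracket (x$1) (x$2) (x$3) * bracket (x$4) (x$2) (x$3) *
      bracket (x$1) (x$4) (x$3) * bracket (x$1) (x$2) (x$4)"
    have "D \<noteq> 0" by (simp add: D_def br)
    then have "frame_matrix x *v frame_combination x (inverse D *s w) = w"
      unfolding frame_matrix_mult frame_coords_combination D_def[symmetric]
      by (simp add: vector_smult_assoc)
    then show ?thesis by (intro exI[of _ "frame_combination x (inverse D *s w)"]) simp
  qed
  then have "surj ((*v) (frame_matrix x))" by (auto simp: surj_def)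
  then show ?thesis
    by (simp add: invertible_right_inverse matrix_right_invertible_surjective)
qed

lemma fixes_first_four_frame_matrix:
  assumes gp: "points_general_position x"
  shows "fixes_first_four (frame_matrix x) x"
proof -
  note br = bracket_nonzero_if_general_position[OF gp]
  have proj: "proj_eq p q" if "c \<noteq> 0" "p = c *s q" "q \<noteq> 0" for c and p q :: "complex ^ 3"
    using that proj_eq_smult by simp
  let ?d4 = "bracket (x$1) (x$2) (x$4)" and ?d3 = "bracket (x$1) (x$4) (x$3)"
    and ?d2 = "bracket (x$4) (x$2) (x$3)" and ?d = "bracket (x$1) (x$2) (x$3)"
  have c: "frame_coords x (x$1) = (?d * ?d3 * ?d4) *s vector [1, 0, 0]"
    "frame_coords x (x$2) = (?d * ?d2 * ?d4) *s vector [0, 1, 0]"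
    "frame_coords x (x$3) = (?d * ?d2 * ?d3) *s vector [0, 0, 1]"
    "frame_coords x (x$4) = (?d2 * ?d3 * ?d4) *s vector [1, 1, 1]"
    by (simp_all add: frame_coords_def vec_eq_iff forall_3)
  show ?thesis
    unfolding fixes_first_four_def frame_matrix_mult standard_frame_def vector_4_nth
    by (intro conjI invertible_frame_matrix[OF gp] proj[OF _ c(1)] proj[OF _ c(2)] proj[OF _ c(3)]
        proj[OF _ c(4)])
      (simp_all add: br vec_eq_iff forall_3)
qed

section \<open>Five general pairs and their normal form\<close>

locale framing =
  fixes x y :: "complex ^ 3 ^ 5" and H K :: "complex ^ 3 ^ 3" and a b :: "complex ^ 3"
  assumes gp: "pairs_general_position x y"
    and H: "fixes_first_four H x" and K: "fixes_first_four K y"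
    and a: "a = H *v (x $ 5)" and b: "b = K *v (y $ 5)"
begin

lemma points: "points_general_position x" "points_general_position y"
  using gp by (simp_all add: pairs_general_position_def)

lemma moves: "moves H x (framed a)" "moves K y (framed b)"
  using fixes_first_four_imp_moves[OF H] fixes_first_four_imp_moves[OF K] points
  unfolding a b points_general_position_def by auto

lemma invertible_HK: "invertible H" "invertible K"
  using moves by (auto simp: moves_def)

lemma brackets:
  "distinct [i, j, k] \<Longrightarrow> bracket (framed a $ i) (framed a $ j) (framed a $ k) \<noteq> 0"
  "distinct [i, j, k] \<Longrightarrow> bracket (framed b $ i) (framed b $ j) (framed b $ k) \<noteq> 0"
  using moves points
  by (simp_all add: bracket_moves_nonzero_iff bracket_nonzero_if_general_position)

lemma generic: "generic_coords a" "generic_coords b"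
  by (intro generic_coords_if_brackets brackets, assumption)+

text \<open>If the fifth points agreed in the normal form, the homography that takes the one frame to the
  other would relate all five pairs.\<close>

lemma not_proportional: "b \<noteq> c *s a"
proof
  assume bc: "b = c *s a"
  have pr: "proj_eq (H *v (x $ i)) (framed a $ i)" "proj_eq (K *v (y $ i)) (framed b $ i)" for i
    using moves by (simp_all add: moves_def)
  have "a \<noteq> 0" "b \<noteq> 0" using generic by (auto simp: generic_coords_def)
  then have "proj_eq b a" using bc unfolding proj_eq_def by blast
  then have ba: "proj_eq a b" by (rule proj_eq_sym)
  have refl: "proj_eq v v" if "v \<noteq> 0" for v :: "complex ^ 3"
    using proj_eq_smult[OF _ that, of 1] by simp
  have "proj_eq (framed a $ i) (framed b $ i)" for i
    by (cases i rule: cases_5) (simp_all add: ba refl vec_eq_iff forall_3)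
  then have hk: "proj_eq (H *v (x $ i)) (K *v (y $ i))" for i
    using pr proj_eq_sym proj_eq_trans by blast
  obtain G where G: "moves G (framed b) y" "\<And>v. G *v (K *v v) = v"
    using moves_back[OF moves(2)] by blast
  have "invertible G" using G(1) by (simp add: moves_def)
  then have "proj_eq ((G ** H) *v (x $ i)) (y $ i)" for i
    using hk[of i] proj_eq_mult_iff[of G "H *v (x $ i)" "K *v (y $ i)"]
    by (simp add: G(2) matrix_vector_mul_assoc[symmetric])
  then have "card {i. proj_eq ((G ** H) *v (x $ i)) (y $ i)} = 5"
    by simp
  moreover have "invertible (G ** H)"
    using invertible_HK(1) \<open>invertible G\<close> by (simp add: invertible_mult)
  ultimately show False
    using gp by (auto simp: pairs_general_position_def)
qed

lemma new_sixth_pair_imp: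
  assumes "new_sixth_pair x y p q"
  shows "no_equal_pencils x y" "den1 a b \<noteq> 0" "den2 a b \<noteq> 0" "den3 a b \<noteq> 0"
    "proj_eq (H *v p) (frame_sixth b a b)" "proj_eq (K *v q) (frame_sixth a a b)"
proof -
  note 1 = new_sixth_pair_framed[OF generic not_proportional new_sixth_pair_moves[OF moves assms]]
  show "den1 a b \<noteq> 0" "den2 a b \<noteq> 0" "den3 a b \<noteq> 0"
    "proj_eq (H *v p) (frame_sixth b a b)" "proj_eq (K *v q) (frame_sixth a a b)"
    by (rule 1)+
  have "no_equal_pencils (framed a) (framed b)"
    using 1 no_equal_pencils_framed_iff[OF brackets] by blast
  then show "no_equal_pencils x y"
    by (simp add: no_equal_pencils_def pencil_cross_ratio_moves[OF moves(1)] pencil_cross_ratio_moves[OF moves(2)])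
qed

lemma new_sixth_pair_exists:
  assumes "no_equal_pencils x y"
  shows "\<exists>p q. new_sixth_pair x y p q"
proof -
  have "no_equal_pencils (framed a) (framed b)"
    using assms
    by (simp add: no_equal_pencils_def pencil_cross_ratio_moves[OF moves(1)] pencil_cross_ratio_moves[OF moves(2)])
  then have "new_sixth_pair (framed a) (framed b) (frame_sixth b a b) (frame_sixth a a b)"
    using no_equal_pencils_framed_iff[OF brackets] generic
    by (intro new_sixth_pair_frame_sixth) blast+
  moreover obtain G where "moves G (framed a) x"
    using moves_back[OF moves(1)] by blast
  moreover obtain L where "moves L (framed b) y"
    using moves_back[OF moves(2)] by blast
  ultimately show ?thesis
    using new_sixth_pair_moves by blast
qed

lemma new_sixth_pair_unique:
  assumes "new_sixth_pair x y p q" "new_sixth_pair x y p' q'"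
  shows "proj_eq p' p" "proj_eq q' q"
proof -
  have "proj_eq (H *v p') (H *v p)" "proj_eq (K *v q') (K *v q)"
    using new_sixth_pair_imp(5,6)[OF assms(1)] new_sixth_pair_imp(5,6)[OF assms(2)] proj_eq_sym proj_eq_trans by blast+
  then show "proj_eq p' p" "proj_eq q' q"
    by (simp_all add: proj_eq_mult_iff invertible_HK)
qed

end

section \<open>The sixth pair as a rational function\<close>

lemma pairs_polynomial_diff:
  assumes "pairs_polynomial f" "pairs_polynomial g"
  shows "pairs_polynomial (\<lambda>x y. f x y - g x y)"
proof -
  have "pairs_polynomial (\<lambda>x y. f x y + (- 1) * g x y)"
    by (intro pairs_polynomial.intros assms)
  then show ?thesis by simp
qed

definition poly_map :: "(complex ^ 3 ^ 5 \<Rightarrow> complex ^ 3 ^ 5 \<Rightarrow> complex ^ 3) \<Rightarrow> bool" where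
  "poly_map P \<longleftrightarrow> (\<forall>k. pairs_polynomial (\<lambda>x y. P x y $ k))"

lemma poly_map_nth: "poly_map P \<Longrightarrow> pairs_polynomial (\<lambda>x y. P x y $ k)"
  by (simp add: poly_map_def)

lemma poly_map_points: "poly_map (\<lambda>x y. x $ i)" "poly_map (\<lambda>x y. y $ i)"
  by (simp_all add: poly_map_def pairs_polynomial.intros)

lemma poly_map_vector:
  assumes "pairs_polynomial f" "pairs_polynomial g" "pairs_polynomial h"
  shows "poly_map (\<lambda>x y. vector [f x y, g x y, h x y])"
  using assms by (simp add: poly_map_def forall_3)

lemma poly_map_add: "poly_map P \<Longrightarrow> poly_map Q \<Longrightarrow> poly_map (\<lambda>x y. P x y + Q x y)"
  by (simp add: poly_map_def pairs_polynomial.add)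

lemma poly_map_smult: "pairs_polynomial f \<Longrightarrow> poly_map P \<Longrightarrow> poly_map (\<lambda>x y. f x y *s P x y)"
  by (simp add: poly_map_def pairs_polynomial.mult)

lemma pairs_polynomial_bracket:
  assumes "poly_map P" "poly_map Q" "poly_map R"
  shows "pairs_polynomial (\<lambda>x y. bracket (P x y) (Q x y) (R x y))"
  unfolding bracket_expand
  by (intro pairs_polynomial_diff pairs_polynomial.add pairs_polynomial.mult poly_map_nth assms)

lemmas polynomial_intros = pairs_polynomial_diff pairs_polynomial.mult pairs_polynomial_bracket
  poly_map_add poly_map_smult poly_map_vector

lemma poly_map_frame_coords:
  assumes "poly_map V"
  shows "poly_map (\<lambda>x y. frame_coords x (V x y))" "poly_map (\<lambda>x y. frame_coords y (V x y))"
  unfolding frame_coords_def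
  by (intro polynomial_intros poly_map_points assms)+

lemma poly_map_frame_combination:
  assumes "poly_map W"
  shows "poly_map (\<lambda>x y. frame_combination x (W x y))" "poly_map (\<lambda>x y. frame_combination y (W x y))"
  unfolding frame_combination_def
  by (intro polynomial_intros poly_map_points poly_map_nth assms)+

text \<open>The formula for the sixth pair multiplied by the three denominators. This is the same point
  wherever they are nonzero.\<close>

definition cleared_sixth :: "complex ^ 3 \<Rightarrow> complex ^ 3 \<Rightarrow> complex ^ 3 \<Rightarrow> complex ^ 3" where
  "cleared_sixth c a b = vector
     [(c$3 - c$2) * (den2 a b * den3 a b), (c$3 - c$1) * (den1 a b * den3 a b),
      (c$1 - c$2) * (den1 a b * den2 a b)]"

lemma cleared_sixth_eq:
  assumes "den1 a b \<noteq> 0" "den2 a b \<noteq> 0" "den3 a b \<noteq> 0"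
  shows "cleared_sixth c a b = (den1 a b * den2 a b * den3 a b) *s frame_sixth c a b"
  using assms by (simp add: vec_eq_iff forall_3 cleared_sixth_def frame_sixth_def)

lemma poly_map_cleared_sixth:
  assumes "poly_map C" "poly_map A" "poly_map B"
  shows "poly_map (\<lambda>x y. cleared_sixth (C x y) (A x y) (B x y))"
  unfolding cleared_sixth_def dens
  by (intro polynomial_intros poly_map_nth assms)

text \<open>The two points of the sixth pair are computed in frame coordinates and moved back.\<close>

definition sixth_fst :: "complex ^ 3 ^ 5 \<Rightarrow> complex ^ 3 ^ 5 \<Rightarrow> complex ^ 3" where
  "sixth_fst x y = (let a = frame_coords x (x$5); b = frame_coords y (y$5)
     in frame_combination x (cleared_sixth b a b))"

definition sixth_snd :: "complex ^ 3 ^ 5 \<Rightarrow> complex ^ 3 ^ 5 \<Rightarrow> complex ^ 3" where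
  "sixth_snd x y = (let a = frame_coords x (x$5); b = frame_coords y (y$5)
     in frame_combination y (cleared_sixth a a b))"

lemma poly_map_sixth: "poly_map sixth_fst" "poly_map sixth_snd"
proof -
  have "poly_map (\<lambda>x y. sixth_fst x y)" "poly_map (\<lambda>x y. sixth_snd x y)"
    unfolding sixth_fst_def sixth_snd_def Let_def
    by (intro poly_map_frame_combination poly_map_cleared_sixth poly_map_frame_coords poly_map_points)+
  then show "poly_map sixth_fst" "poly_map sixth_snd" by simp_all
qed

lemma proj_eq_frame_combination:
  assumes gp: "points_general_position x" and p: "proj_eq (frame_matrix x *v p) w"
  shows "proj_eq p (frame_combination x w)"
proof -
  define D where "D = bracket (x$1) (x$2) (x$3) * bracket (x$4) (x$2) (x$3) *
      bracket (x$1) (x$4) (x$3) * bracket (x$1) (x$2) (x$4)"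
  have "D \<noteq> 0"
    by (simp add: D_def bracket_nonzero_if_general_position[OF gp])
  moreover have "w \<noteq> 0" using p by (simp add: proj_eq_def)
  ultimately have "proj_eq w (D *s w)"
    by (intro proj_eq_sym[OF proj_eq_smult])
  then have "proj_eq (frame_matrix x *v p) (frame_matrix x *v frame_combination x w)"
    using p proj_eq_trans unfolding frame_matrix_mult[of x "frame_combination x w"] frame_coords_combination D_def
    by blast
  then show ?thesis
    using invertible_frame_matrix[OF gp] by (simp add: proj_eq_mult_iff)
qed

lemma new_sixth_pair_imp_sixth:
  assumes gp: "pairs_general_position x y" and new: "new_sixth_pair x y p q"
  shows "proj_eq p (sixth_fst x y)" "proj_eq q (sixth_snd x y)"
proof -
  have points: "points_general_position x" "points_general_position y"
    using gp by (simp_all add: pairs_general_position_def)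
  define a where "a = frame_coords x (x$5)"
  define b where "b = frame_coords y (y$5)"
  interpret framing x y "frame_matrix x" "frame_matrix y" a b
    by unfold_locales (simp_all add: gp fixes_first_four_frame_matrix points a_def b_def frame_matrix_mult)
  note n = new_sixth_pair_imp[OF new]
  have cl: "proj_eq v (cleared_sixth c a b)" if "proj_eq v (frame_sixth c a b)" for v c
  proof -
    have "frame_sixth c a b \<noteq> 0" using that by (simp add: proj_eq_def)
    then have "proj_eq (frame_sixth c a b) (cleared_sixth c a b)"
      unfolding cleared_sixth_eq[OF n(2-4)] using n(2-4) by (intro proj_eq_sym[OF proj_eq_smult]) simp_all
    with that show ?thesis by (rule proj_eq_trans)
  qed
  show "proj_eq p (sixth_fst x y)"
    using proj_eq_frame_combination[OF points(1) cl[OF n(5)]]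
    by (simp add: sixth_fst_def a_def b_def Let_def)
  show "proj_eq q (sixth_snd x y)"
    using proj_eq_frame_combination[OF points(2) cl[OF n(6)]]
    by (simp add: sixth_snd_def a_def b_def Let_def)
qed

lemma no_equal_pencils_iff_unique_sixth:
  assumes gp: "pairs_general_position x y"
  shows "no_equal_pencils x y \<longleftrightarrow>
    (\<exists>p q. new_sixth_pair x y p q \<and>
       (\<forall>p' q'. new_sixth_pair x y p' q' \<longrightarrow> proj_eq p' p \<and> proj_eq q' q))"
proof -
  have points: "points_general_position x" "points_general_position y"
    using gp by (simp_all add: pairs_general_position_def)
  interpret framing x y "frame_matrix x" "frame_matrix y" "frame_matrix x *v (x$5)" "frame_matrix y *v (y$5)"
    by unfold_locales (simp_all add: gp fixes_first_four_frame_matrix points)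
  show ?thesis
  proof
    assume "no_equal_pencils x y"
    then obtain p q where pq: "new_sixth_pair x y p q"
      using new_sixth_pair_exists by blast
    show "\<exists>p q. new_sixth_pair x y p q \<and>
       (\<forall>p' q'. new_sixth_pair x y p' q' \<longrightarrow> proj_eq p' p \<and> proj_eq q' q)"
      by (intro exI[of _ p] exI[of _ q] conjI allI impI pq new_sixth_pair_unique[OF pq])
  next
    assume "\<exists>p q. new_sixth_pair x y p q \<and>
       (\<forall>p' q'. new_sixth_pair x y p' q' \<longrightarrow> proj_eq p' p \<and> proj_eq q' q)"
    then show "no_equal_pencils x y" using new_sixth_pair_imp(1) by blast
  qed
qed

lemma sixth_pair_formula:
  assumes "pairs_general_position x y" "new_sixth_pair x y p q"
    and "fixes_first_four H x" "fixes_first_four K y" "a = H *v (x $ 5)" "b = K *v (y $ 5)"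
  shows "den1 a b \<noteq> 0" "den2 a b \<noteq> 0" "den3 a b \<noteq> 0"
    "proj_eq (H *v p) (frame_sixth b a b)" "proj_eq (K *v q) (frame_sixth a a b)"
proof -
  interpret framing x y H K a b by unfold_locales (use assms in simp_all)
  show "den1 a b \<noteq> 0" "den2 a b \<noteq> 0" "den3 a b \<noteq> 0"
    "proj_eq (H *v p) (frame_sixth b a b)" "proj_eq (K *v q) (frame_sixth a a b)"
    using new_sixth_pair_imp[OF assms(2)] by blast+
qed

theorem lemma6p1:
  shows
    "(\<forall>x y. pairs_general_position x y \<longrightarrow>
        (no_equal_pencils x y \<longleftrightarrow>
          (\<exists>p q. new_sixth_pair x y p q \<and>
             (\<forall>p' q'. new_sixth_pair x y p' q' \<longrightarrow> proj_eq p' p \<and> proj_eq q' q)))) \<and>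
     (\<exists>P Q :: complex ^ 3 ^ 5 \<Rightarrow> complex ^ 3 ^ 5 \<Rightarrow> complex ^ 3.
        (\<forall>k. pairs_polynomial (\<lambda>x y. P x y $ k) \<and> pairs_polynomial (\<lambda>x y. Q x y $ k)) \<and>
        (\<forall>x y p q. pairs_general_position x y \<and> new_sixth_pair x y p q \<longrightarrow>
           proj_eq p (P x y) \<and> proj_eq q (Q x y))) \<and>
     (\<forall>x y p q H K a b.
        pairs_general_position x y \<and> new_sixth_pair x y p q \<and>
        fixes_first_four H x \<and> fixes_first_four K y \<and>
        a = H *v (x $ 5) \<and> b = K *v (y $ 5) \<longrightarrow>
          b$3 * a$2 - a$3 * b$2 \<noteq> 0 \<and>
          b$3 * a$1 - a$3 * b$1 \<noteq> 0 \<and>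
          b$1 * a$2 - a$1 * b$2 \<noteq> 0 \<and>
          proj_eq (H *v p) (vector
            [(b$3 - b$2) / (b$3 * a$2 - a$3 * b$2),
             (b$3 - b$1) / (b$3 * a$1 - a$3 * b$1),
             (b$1 - b$2) / (b$1 * a$2 - a$1 * b$2)]) \<and>
          proj_eq (K *v q) (vector
            [(a$3 - a$2) / (b$3 * a$2 - a$3 * b$2),
             (a$3 - a$1) / (b$3 * a$1 - a$3 * b$1),
             (a$1 - a$2) / (b$1 * a$2 - a$1 * b$2)]))"
proof (intro conjI allI impI)
  show "no_equal_pencils x y \<longleftrightarrow>
          (\<exists>p q. new_sixth_pair x y p q \<and>
             (\<forall>p' q'. new_sixth_pair x y p' q' \<longrightarrow> proj_eq p' p \<and> proj_eq q' q))"
    if "pairs_general_position x y" for x y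
    using that by (rule no_equal_pencils_iff_unique_sixth)
  show "\<exists>P Q :: complex ^ 3 ^ 5 \<Rightarrow> complex ^ 3 ^ 5 \<Rightarrow> complex ^ 3.
        (\<forall>k. pairs_polynomial (\<lambda>x y. P x y $ k) \<and> pairs_polynomial (\<lambda>x y. Q x y $ k)) \<and>
        (\<forall>x y p q. pairs_general_position x y \<and> new_sixth_pair x y p q \<longrightarrow>
           proj_eq p (P x y) \<and> proj_eq q (Q x y))"
    using poly_map_sixth new_sixth_pair_imp_sixth
    by (intro exI[of _ sixth_fst] exI[of _ sixth_snd]) (auto simp: poly_map_def)
  fix x y p q H K a b
  assume "pairs_general_position x y \<and> new_sixth_pair x y p q \<and>
    fixes_first_four H x \<and> fixes_first_four K y \<and> a = H *v (x $ 5) \<and> b = K *v (y $ 5)"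
  then have *: "pairs_general_position x y" "new_sixth_pair x y p q"
    "fixes_first_four H x" "fixes_first_four K y" "a = H *v (x $ 5)" "b = K *v (y $ 5)"
    by simp_all
  note formula = sixth_pair_formula[OF *, unfolded dens frame_sixth_def]
  show "b$3 * a$2 - a$3 * b$2 \<noteq> 0" "b$3 * a$1 - a$3 * b$1 \<noteq> 0" "b$1 * a$2 - a$1 * b$2 \<noteq> 0"
    by (fact formula)+
  show "proj_eq (H *v p) (vector
            [(b$3 - b$2) / (b$3 * a$2 - a$3 * b$2),
             (b$3 - b$1) / (b$3 * a$1 - a$3 * b$1),
             (b$1 - b$2) / (b$1 * a$2 - a$1 * b$2)])"
    by (fact formula)
  show "proj_eq (K *v q) (vector
            [(a$3 - a$2) / (b$3 * a$2 - a$3 * b$2),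
             (a$3 - a$1) / (b$3 * a$1 - a$3 * b$1),
             (a$1 - a$2) / (b$1 * a$2 - a$1 * b$2)])"
    by (fact formula)
qed

end
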